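(* In the asynchronous semantics, the model-checking problem for $\exists^\ast\forall^\ast$-\textsf{HyperMTL} is undecidable, and the model-checking problem for $\forall^\ast\exists^\ast$-\textsf{HyperMTL} is undecidable. That is, there is no algorithm that, given a timed automaton $\mathcal{A}$ over $\Sigma_{AP}$ and a closed \textsf{HyperMTL} formula $\phi$ over $AP$ whose quantifier prefix is a block of existential quantifiers followed by a block of universal quantifiers (resp. universal followed by existential), decides whether $[\![\mathcal{A}]\!]\models\phi$.
   Context: Fix a finite set $AP$ of atomic propositions and let $\Sigma_{AP}=2^{AP}$. A timed word (trace) over a finite alphabet $\Sigma$ is a finite sequence $\rho=(\sigma_1,\tau_1)\cdots(\sigma_n,\tau_n)$ with $\sigma_i\in\Sigma$, $\tau_i\in\mathbb{R}_{\ge 0}$ and $\tau_1<\dots<\tau_n$; write $t\in\rho$ iff $t=\tau_i$ for some $i$, and then $\rho(t)=\sigma_i$. $T\Sigma^\ast$ is the set of all timed words over $\Sigma$. A timed automaton (TA) over $\Sigma$ is $\langle\Sigma,S,s_0,X,\Delta,F\rangle$ with finite set of locations $S$, initial location $s_0$, finite set of clocks $X$, transitions $\Delta\subseteq S\times\Sigma\times G(X)\times2^X\times S$ and accepting locations $F\subseteq S$, where guards are generated by $g::=\top\mid g\wedge g\mid x\bowtie c$ with $\bowtie\in\{\le,<,\ge,>\}$, $x\in X$, $c\in\mathbb{N}$. A run on $(\sigma_1,\tau_1)\cdots(\sigma_n,\tau_n)$ is $(s_0,v_0)\cdots(s_n,v_n)$ with $v_0\equiv0$ and, for each $i<n$,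 a transition $(s_i,\sigma_{i+1},g,\lambda,s_{i+1})$ with $v_i+(\tau_{i+1}-\tau_i)\models g$ ($\tau_0=0$) and $v_{i+1}=(v_i+(\tau_{i+1}-\tau_i))[\lambda\leftarrow0]$; it is accepting if $s_n\in F$. $[\![\mathcal{A}]\!]$ is the set of timed words with an accepting run. \textsf{HyperMTL} syntax: with an infinite set $V$ of trace variables, formulae are $\phi::=\exists\pi\,\phi\mid\forall\pi\,\phi\mid\psi$ and $\psi::=\top\mid\top_\pi\mid p_\pi\mid\psi_1\wedge\psi_2\mid\neg\psi\mid\psi_1\,\mathbf{U}_I\,\psi_2\mid\psi_1\,\mathbf{S}_I\,\psi_2$, where $\pi\in V$, $p\in AP$, and $I\subseteq\mathbb{R}_{\ge0}$ is a non-singular interval with endpoints in $\mathbb{N}\cup\{\infty\}$; each quantifier binds a fresh variable; closed means no free trace variables. Derived: $\bot=\neg\top$, $\vee$, $\psi_1\widetilde{\mathbf{U}}_I\psi_2=\neg((\neg\psi_1)\mathbf{U}_I(\neg\psi_2))$, $\psi_1\widetilde{\mathbf{S}}_I\psi_2=\neg((\neg\psi_1)\mathbf{S}_I(\neg\psi_2))$. Asynchronous semantics: for $T\subseteq T\Sigma_{AP}^\ast$, a partial map $\Pi:V\to T\Sigma_{AP}^\ast$ and $t\ge0$: $(T,t)\models_\Pi\top$ iff $t\in\rho$ for some $\rho$ in the range of $\Pi$ ($\bot$ iff not); $\top_\pi$ iff $t\in\Pi(\pi)$ (its negation iff $t\notin\Pi(\pi)$); $p_\pi$ iff $t\in\Pi(\pi)$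 and $p\in\Pi(\pi)(t)$; $\neg p_\pi$ iff $t\in\Pi(\pi)$ and $p\notin\Pi(\pi)(t)$; $\wedge,\vee$ as usual; $\psi_1\mathbf{U}_I\psi_2$ at $t$ iff there is $t'>t$ with $t'-t\in I$, $\top$ and $\psi_2$ holding at $t'$, and $\psi_1$ holding at every $t''\in(t,t')$ at which $\top$ holds; $\psi_1\widetilde{\mathbf{U}}_I\psi_2$ at $t$ iff for every $t'>t$ with $t'-t\in I$ at which $\top$ holds, $\psi_2$ holds at $t'$ or $\psi_1$ holds at some $t''\in(t,t')$ at which $\top$ holds; $\mathbf{S}_I,\widetilde{\mathbf{S}}_I$ are the past mirrors ($0\le t'<t$, $t-t'\in I$, $t''\in(t',t)$); $\neg\psi$ is evaluated as the negation normal form of $\neg\psi$; $\exists\pi\,\phi$ iff $(T,t)\models_{\Pi[\pi\mapsto\rho]}\phi$ for some $\rho\in T$; $\forall\pi\,\phi$ iff for all $\rho\in T$. $T\models\phi$ iff $(T,0)\models_{\Pi_\emptyset}\phi$. *)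

theory Defs
  imports Complex_Main "HOL-Library.Nat_Bijection"
begin

section \<open>Timed words and timed automata\<close>

type_synonym 'a timed_word = "('a \<times> real) list"

definition timed_words :: "'a set \<Rightarrow> 'a timed_word set" where
  "timed_words \<Sigma> = {\<rho>. fst ` set \<rho> \<subseteq> \<Sigma> \<and> (\<forall>t \<in> snd ` set \<rho>. 0 \<le> t) \<and> sorted_wrt (<) (map snd \<rho>)}"

definition times :: "'a timed_word \<Rightarrow> real set" where
  "times \<rho> = snd ` set \<rho>"

text \<open>Meaningful for \<open>t \<in> times \<rho>\<close>, where the letter is unique since time stamps are
  strictly increasing.\<close>
definition letter_at :: "'a timed_word \<Rightarrow> real \<Rightarrow> 'a" where
  "letter_at \<rho> t = (THE a. (a, t) \<in> set \<rho>)"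

datatype cmp = LE | LT | GE | GT

datatype 'x guard = GTrue | GAnd "'x guard" "'x guard" | GCmp 'x cmp nat

primrec guard_clocks :: "'x guard \<Rightarrow> 'x set" where
  "guard_clocks GTrue = {}"
| "guard_clocks (GAnd g h) = guard_clocks g \<union> guard_clocks h"
| "guard_clocks (GCmp x c n) = {x}"

primrec sat_cmp :: "cmp \<Rightarrow> real \<Rightarrow> real \<Rightarrow> bool" where
  "sat_cmp LE a b \<longleftrightarrow> a \<le> b"
| "sat_cmp LT a b \<longleftrightarrow> a < b"
| "sat_cmp GE a b \<longleftrightarrow> a \<ge> b"
| "sat_cmp GT a b \<longleftrightarrow> a > b"

primrec sat_guard :: "('x \<Rightarrow> real) \<Rightarrow> 'x guard \<Rightarrow> bool" where
  "sat_guard v GTrue \<longleftrightarrow> True"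
| "sat_guard v (GAnd g h) \<longleftrightarrow> sat_guard v g \<and> sat_guard v h"
| "sat_guard v (GCmp x c n) \<longleftrightarrow> sat_cmp c (v x) (real n)"

record ('a, 's, 'x) ta =
  alphabet :: "'a set"
  locs :: "'s set"
  init :: 's
  clocks :: "'x set"
  trans :: "('s \<times> 'a \<times> 'x guard \<times> 'x set \<times> 's) set"
  accepting :: "'s set"

text \<open>The set of transitions is required to be finite: this does not follow from the finiteness
  of the other components, because there are infinitely many guards.\<close>
definition timed_automaton :: "('a, 's, 'x) ta \<Rightarrow> bool" where
  "timed_automaton A \<longleftrightarrow>
     finite (alphabet A) \<and> finite (locs A) \<and> init A \<in> locs A \<and> finite (clocks A) \<and>
     finite (trans A) \<and>
     trans A \<subseteq> locs A \<times> alphabet A \<times> {g. guard_clocks g \<subseteq> clocks A} \<times> Pow (clocks A) \<times> locs A \<and>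
     accepting A \<subseteq> locs A"

definition delay :: "('x \<Rightarrow> real) \<Rightarrow> real \<Rightarrow> ('x \<Rightarrow> real)" where
  "delay v d = (\<lambda>x. v x + d)"

definition reset :: "('x \<Rightarrow> real) \<Rightarrow> 'x set \<Rightarrow> ('x \<Rightarrow> real)" where
  "reset v Y = (\<lambda>x. if x \<in> Y then 0 else v x)"

text \<open>The time elapsed before the event with list index \<open>i\<close>; the first event is measured from
  time \<open>0\<close>.\<close>
definition elapse :: "'a timed_word \<Rightarrow> nat \<Rightarrow> real" where
  "elapse \<rho> i = snd (\<rho> ! i) - (if i = 0 then 0 else snd (\<rho> ! (i - 1)))"

definition run_on :: "('a, 's, 'x) ta \<Rightarrow> 'a timed_word \<Rightarrow> ('s \<times> ('x \<Rightarrow> real)) list \<Rightarrow> bool" where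
  "run_on A \<rho> r \<longleftrightarrow>
     length r = length \<rho> + 1 \<and> r ! 0 = (init A, \<lambda>_. 0) \<and>
     (\<forall>i < length \<rho>. \<exists>g Y.
        (fst (r ! i), fst (\<rho> ! i), g, Y, fst (r ! (i + 1))) \<in> trans A \<and>
        sat_guard (delay (snd (r ! i)) (elapse \<rho> i)) g \<and>
        snd (r ! (i + 1)) = reset (delay (snd (r ! i)) (elapse \<rho> i)) Y)"

definition language :: "('a, 's, 'x) ta \<Rightarrow> 'a timed_word set" where
  "language A = {\<rho> \<in> timed_words (alphabet A). \<exists>r. run_on A \<rho> r \<and> fst (last r) \<in> accepting A}"


section \<open>Syntax of HyperMTL\<close>

text \<open>\<open>Bounded l_closed l u u_closed\<close> has endpoints \<open>l\<close> and \<open>u\<close>;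
  \<open>Unbounded l_closed l\<close> has endpoints \<open>l\<close> and \<open>\<infinity>\<close>.\<close>
datatype ivl = Bounded bool nat nat bool | Unbounded bool nat

primrec ivl_set :: "ivl \<Rightarrow> real set" where
  "ivl_set (Bounded lc l u uc) =
     (if lc then {real l..} else {real l<..}) \<inter> (if uc then {..real u} else {..<real u})"
| "ivl_set (Unbounded lc l) = (if lc then {real l..} else {real l<..})"

primrec nonsingular :: "ivl \<Rightarrow> bool" where
  "nonsingular (Bounded lc l u uc) \<longleftrightarrow> l < u"
| "nonsingular (Unbounded lc l) \<longleftrightarrow> True"

type_synonym tvar = nat

text \<open>\<open>TT\<close> is \<open>\<top>\<close> (some trace has an event now), \<open>Ev \<pi>\<close> is \<open>\<top>\<^sub>\<pi>\<close> and \<open>Atom p \<pi>\<close> is \<open>p\<^sub>\<pi>\<close>.\<close>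
datatype 'p mtl =
    TT
  | Ev tvar
  | Atom 'p tvar
  | Conj "'p mtl" "'p mtl"
  | Neg "'p mtl"
  | Until ivl "'p mtl" "'p mtl"
  | Since ivl "'p mtl" "'p mtl"

datatype 'p hypermtl =
    Exists tvar "'p hypermtl"
  | Forall tvar "'p hypermtl"
  | Body "'p mtl"

primrec mtl_vars :: "'p mtl \<Rightarrow> tvar set" where
  "mtl_vars TT = {}"
| "mtl_vars (Ev \<pi>) = {\<pi>}"
| "mtl_vars (Atom p \<pi>) = {\<pi>}"
| "mtl_vars (Conj a b) = mtl_vars a \<union> mtl_vars b"
| "mtl_vars (Neg a) = mtl_vars a"
| "mtl_vars (Until I a b) = mtl_vars a \<union> mtl_vars b"
| "mtl_vars (Since I a b) = mtl_vars a \<union> mtl_vars b"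

primrec mtl_over :: "'p set \<Rightarrow> 'p mtl \<Rightarrow> bool" where
  "mtl_over AP TT \<longleftrightarrow> True"
| "mtl_over AP (Ev \<pi>) \<longleftrightarrow> True"
| "mtl_over AP (Atom p \<pi>) \<longleftrightarrow> p \<in> AP"
| "mtl_over AP (Conj a b) \<longleftrightarrow> mtl_over AP a \<and> mtl_over AP b"
| "mtl_over AP (Neg a) \<longleftrightarrow> mtl_over AP a"
| "mtl_over AP (Until I a b) \<longleftrightarrow> nonsingular I \<and> mtl_over AP a \<and> mtl_over AP b"
| "mtl_over AP (Since I a b) \<longleftrightarrow> nonsingular I \<and> mtl_over AP a \<and> mtl_over AP b"

primrec free_vars :: "'p hypermtl \<Rightarrow> tvar set" where
  "free_vars (Exists \<pi> \<phi>) = free_vars \<phi> - {\<pi>}"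
| "free_vars (Forall \<pi> \<phi>) = free_vars \<phi> - {\<pi>}"
| "free_vars (Body \<psi>) = mtl_vars \<psi>"

primrec bound_vars :: "'p hypermtl \<Rightarrow> tvar list" where
  "bound_vars (Exists \<pi> \<phi>) = \<pi> # bound_vars \<phi>"
| "bound_vars (Forall \<pi> \<phi>) = \<pi> # bound_vars \<phi>"
| "bound_vars (Body \<psi>) = []"

primrec matrix :: "'p hypermtl \<Rightarrow> 'p mtl" where
  "matrix (Exists \<pi> \<phi>) = matrix \<phi>"
| "matrix (Forall \<pi> \<phi>) = matrix \<phi>"
| "matrix (Body \<psi>) = \<psi>"

definition closed_hypermtl :: "'p set \<Rightarrow> 'p hypermtl \<Rightarrow> bool" where
  "closed_hypermtl AP \<phi> \<longleftrightarrow>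
     mtl_over AP (matrix \<phi>) \<and> distinct (bound_vars \<phi>) \<and> free_vars \<phi> = {}"

fun exists_block :: "'p hypermtl \<Rightarrow> bool" where
  "exists_block (Exists \<pi> \<phi>) \<longleftrightarrow> exists_block \<phi>"
| "exists_block (Forall \<pi> \<phi>) \<longleftrightarrow> False"
| "exists_block (Body \<psi>) \<longleftrightarrow> True"

fun forall_block :: "'p hypermtl \<Rightarrow> bool" where
  "forall_block (Forall \<pi> \<phi>) \<longleftrightarrow> forall_block \<phi>"
| "forall_block (Exists \<pi> \<phi>) \<longleftrightarrow> False"
| "forall_block (Body \<psi>) \<longleftrightarrow> True"

fun exists_forall :: "'p hypermtl \<Rightarrow> bool" where
  "exists_forall (Exists \<pi> \<phi>) \<longleftrightarrow> exists_forall \<phi>"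
| "exists_forall \<phi> \<longleftrightarrow> forall_block \<phi>"

fun forall_exists :: "'p hypermtl \<Rightarrow> bool" where
  "forall_exists (Forall \<pi> \<phi>) \<longleftrightarrow> forall_exists \<phi>"
| "forall_exists \<phi> \<longleftrightarrow> exists_block \<phi>"


section \<open>Asynchronous semantics\<close>

text \<open>Negation is not Boolean complementation: \<open>\<not> p\<^sub>\<pi>\<close> requires an event of \<open>\<pi>\<close> at
  the current time, just like \<open>p\<^sub>\<pi>\<close>. The semantics therefore goes through negation normal form.\<close>
datatype 'p nnf =
    NTT
  | NFF
  | NEv tvar
  | NNoEv tvar
  | NAtom 'p tvar
  | NNegAtom 'p tvar
  | NConj "'p nnf" "'p nnf"
  | NDisj "'p nnf" "'p nnf"
  | NUntil ivl "'p nnf" "'p nnf"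
  | NDualUntil ivl "'p nnf" "'p nnf"
  | NSince ivl "'p nnf" "'p nnf"
  | NDualSince ivl "'p nnf" "'p nnf"

fun to_nnf :: "'p mtl \<Rightarrow> 'p nnf" where
  "to_nnf TT = NTT"
| "to_nnf (Ev \<pi>) = NEv \<pi>"
| "to_nnf (Atom p \<pi>) = NAtom p \<pi>"
| "to_nnf (Conj a b) = NConj (to_nnf a) (to_nnf b)"
| "to_nnf (Until I a b) = NUntil I (to_nnf a) (to_nnf b)"
| "to_nnf (Since I a b) = NSince I (to_nnf a) (to_nnf b)"
| "to_nnf (Neg TT) = NFF"
| "to_nnf (Neg (Ev \<pi>)) = NNoEv \<pi>"
| "to_nnf (Neg (Atom p \<pi>)) = NNegAtom p \<pi>"
| "to_nnf (Neg (Conj a b)) = NDisj (to_nnf (Neg a)) (to_nnf (Neg b))"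
| "to_nnf (Neg (Neg a)) = to_nnf a"
| "to_nnf (Neg (Until I a b)) = NDualUntil I (to_nnf (Neg a)) (to_nnf (Neg b))"
| "to_nnf (Neg (Since I a b)) = NDualSince I (to_nnf (Neg a)) (to_nnf (Neg b))"

type_synonym 'p assignment = "tvar \<Rightarrow> 'p set timed_word option"

definition event :: "'p assignment \<Rightarrow> real \<Rightarrow> bool" where
  "event \<Pi> t \<longleftrightarrow> (\<exists>\<rho> \<in> ran \<Pi>. t \<in> times \<rho>)"

text \<open>The clauses for literals are only relevant for \<open>\<pi>\<close> in the domain of \<open>\<Pi>\<close>; this is
  always the case when a closed formula is evaluated.\<close>
primrec sat_nnf :: "'p assignment \<Rightarrow> real \<Rightarrow> 'p nnf \<Rightarrow> bool" where
  "sat_nnf \<Pi> t NTT \<longleftrightarrow> event \<Pi> t"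
| "sat_nnf \<Pi> t NFF \<longleftrightarrow> \<not> event \<Pi> t"
| "sat_nnf \<Pi> t (NEv \<pi>) \<longleftrightarrow> (\<exists>\<rho>. \<Pi> \<pi> = Some \<rho> \<and> t \<in> times \<rho>)"
| "sat_nnf \<Pi> t (NNoEv \<pi>) \<longleftrightarrow> (\<exists>\<rho>. \<Pi> \<pi> = Some \<rho> \<and> t \<notin> times \<rho>)"
| "sat_nnf \<Pi> t (NAtom p \<pi>) \<longleftrightarrow> (\<exists>\<rho>. \<Pi> \<pi> = Some \<rho> \<and> t \<in> times \<rho> \<and> p \<in> letter_at \<rho> t)"
| "sat_nnf \<Pi> t (NNegAtom p \<pi>) \<longleftrightarrow> (\<exists>\<rho>. \<Pi> \<pi> = Some \<rho> \<and> t \<in> times \<rho> \<and> p \<notin> letter_at \<rho> t)"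
| "sat_nnf \<Pi> t (NConj a b) \<longleftrightarrow> sat_nnf \<Pi> t a \<and> sat_nnf \<Pi> t b"
| "sat_nnf \<Pi> t (NDisj a b) \<longleftrightarrow> sat_nnf \<Pi> t a \<or> sat_nnf \<Pi> t b"
| "sat_nnf \<Pi> t (NUntil I a b) \<longleftrightarrow>
     (\<exists>t'>t. t' - t \<in> ivl_set I \<and> event \<Pi> t' \<and> sat_nnf \<Pi> t' b \<and>
        (\<forall>t'' \<in> {t<..<t'}. event \<Pi> t'' \<longrightarrow> sat_nnf \<Pi> t'' a))"
| "sat_nnf \<Pi> t (NDualUntil I a b) \<longleftrightarrow>
     (\<forall>t'>t. t' - t \<in> ivl_set I \<and> event \<Pi> t' \<longrightarrow> sat_nnf \<Pi> t' b \<or>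
        (\<exists>t'' \<in> {t<..<t'}. event \<Pi> t'' \<and> sat_nnf \<Pi> t'' a))"
| "sat_nnf \<Pi> t (NSince I a b) \<longleftrightarrow>
     (\<exists>t' \<ge> 0. t' < t \<and> t - t' \<in> ivl_set I \<and> event \<Pi> t' \<and> sat_nnf \<Pi> t' b \<and>
        (\<forall>t'' \<in> {t'<..<t}. event \<Pi> t'' \<longrightarrow> sat_nnf \<Pi> t'' a))"
| "sat_nnf \<Pi> t (NDualSince I a b) \<longleftrightarrow>
     (\<forall>t' \<ge> 0. t' < t \<and> t - t' \<in> ivl_set I \<and> event \<Pi> t' \<longrightarrow> sat_nnf \<Pi> t' b \<or>
        (\<exists>t'' \<in> {t'<..<t}. event \<Pi> t'' \<and> sat_nnf \<Pi> t'' a))"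

primrec sat_hyper ::
    "'p set timed_word set \<Rightarrow> 'p assignment \<Rightarrow> real \<Rightarrow> 'p hypermtl \<Rightarrow> bool" where
  "sat_hyper T \<Pi> t (Exists \<pi> \<phi>) \<longleftrightarrow> (\<exists>\<rho> \<in> T. sat_hyper T (\<Pi>(\<pi> \<mapsto> \<rho>)) t \<phi>)"
| "sat_hyper T \<Pi> t (Forall \<pi> \<phi>) \<longleftrightarrow> (\<forall>\<rho> \<in> T. sat_hyper T (\<Pi>(\<pi> \<mapsto> \<rho>)) t \<phi>)"
| "sat_hyper T \<Pi> t (Body \<psi>) \<longleftrightarrow> sat_nnf \<Pi> t (to_nnf \<psi>)"

definition models :: "'p set timed_word set \<Rightarrow> 'p hypermtl \<Rightarrow> bool" where
  "models T \<phi> \<longleftrightarrow> sat_hyper T Map.empty 0 \<phi>"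


section \<open>Algorithms: partial recursive functions\<close>

datatype recf = Zero | Succ | Proj nat | Comp recf "recf list" | PrimRec recf recf | Mu recf

text \<open>\<open>computes f xs y\<close>: the evaluation of \<open>f\<close> at the arguments \<open>xs\<close> terminates
  with value \<open>y\<close>. Recursion is on the first argument, and \<open>Mu\<close> searches for the least
  first argument at which the function is \<open>0\<close>, all smaller ones having a defined value.\<close>
inductive computes :: "recf \<Rightarrow> nat list \<Rightarrow> nat \<Rightarrow> bool" where
  zero: "computes Zero xs 0"
| succ: "computes Succ [x] (Suc x)"
| proj: "i < length xs \<Longrightarrow> computes (Proj i) xs (xs ! i)"
| comp: "list_all2 (\<lambda>g y. computes g xs y) gs ys \<Longrightarrow> computes f ys z \<Longrightarrow> computes (Comp f gs) xs z"
| prim_0: "computes f xs z \<Longrightarrow> computes (PrimRec f g) (0 # xs) z"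
| prim_Suc: "computes (PrimRec f g) (n # xs) y \<Longrightarrow> computes g (n # y # xs) z \<Longrightarrow>
    computes (PrimRec f g) (Suc n # xs) z"
| mu: "computes f (n # xs) 0 \<Longrightarrow> \<forall>m<n. \<exists>k. computes f (m # xs) (Suc k) \<Longrightarrow> computes (Mu f) xs n"

inductive_cases computes_elims:
  "computes Zero xs y"
  "computes Succ xs y"
  "computes (Proj i) xs y"
  "computes (Comp f gs) xs y"
  "computes (PrimRec f g) (0 # xs) y"
  "computes (PrimRec f g) (Suc n # xs) y"
  "computes (Mu f) xs y"

lemma computes_deterministic: "computes f xs y \<Longrightarrow> computes f xs z \<Longrightarrow> y = z"
proof (induction arbitrary: z rule: computes.induct)
  case (zero xs)
  then show ?case by (rule computes_elims(1)) simp
next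
  case (succ x)
  then show ?case by (rule computes_elims(2)) simp
next
  case (proj i xs)
  from proj(2) show ?case by (rule computes_elims(3)) simp
next
  case (comp xs gs ys f w)
  from comp.prems obtain ys' where
    ys': "list_all2 (\<lambda>g y. computes g xs y) gs ys'" "computes f ys' z"
    by (rule computes_elims(4))
  have "ys = ys'"
    using comp.IH(1) ys'(1) by (simp add: list_all2_conv_all_nth list_eq_iff_nth_eq)
  then show ?case using comp.IH(2) ys'(2) by simp
next
  case (prim_0 f xs w g)
  from prim_0.prems show ?case by (rule computes_elims(5)) (rule prim_0.IH)
next
  case (prim_Suc f g n xs y w)
  from prim_Suc.prems obtain y' where y': "computes (PrimRec f g) (n # xs) y'"
    "computes g (n # y' # xs) z"
    by (rule computes_elims(6))
  then show ?case using prim_Suc.IH by blast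
next
  case (mu f n xs)
  from mu.prems have z: "computes f (z # xs) 0" "\<forall>m<z. \<exists>k. computes f (m # xs) (Suc k)"
    by (rule computes_elims(7); simp)+
  have "\<not> n < z" using z(2) mu.IH(1) by fastforce
  moreover have "\<not> z < n" using z(1) mu.IH(2) by fastforce
  ultimately show ?case by simp
qed

text \<open>Nothing is required of the algorithm on inputs that do not encode an instance.\<close>
definition decidable_on :: "('i \<Rightarrow> nat) \<Rightarrow> 'i set \<Rightarrow> ('i \<Rightarrow> bool) \<Rightarrow> bool" where
  "decidable_on enc Inst P \<longleftrightarrow> (\<exists>f. \<forall>x \<in> Inst. computes f [enc x] (if P x then 1 else 0))"


section \<open>The model-checking problem\<close>

text \<open>As inputs to algorithms, automata have locations and clocks named by natural numbers,
  and propositions are natural numbers too. Finite sets are coded by \<open>set_encode\<close>.\<close>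

type_synonym input_ta = "(nat set, nat, nat) ta"

primrec encode_cmp :: "cmp \<Rightarrow> nat" where
  "encode_cmp LE = 0"
| "encode_cmp LT = 1"
| "encode_cmp GE = 2"
| "encode_cmp GT = 3"

primrec encode_guard :: "nat guard \<Rightarrow> nat" where
  "encode_guard GTrue = list_encode [0]"
| "encode_guard (GAnd g h) = list_encode [1, encode_guard g, encode_guard h]"
| "encode_guard (GCmp x c n) = list_encode [2, x, encode_cmp c, n]"

definition encode_trans :: "nat \<times> nat set \<times> nat guard \<times> nat set \<times> nat \<Rightarrow> nat" where
  "encode_trans = (\<lambda>(s, a, g, Y, s').
     list_encode [s, set_encode a, encode_guard g, set_encode Y, s'])"

definition encode_ta :: "input_ta \<Rightarrow> nat" where
  "encode_ta A = list_encode
     [set_encode (set_encode ` alphabet A), set_encode (locs A), init A, set_encode (clocks A),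
      set_encode (encode_trans ` trans A), set_encode (accepting A)]"

primrec encode_ivl :: "ivl \<Rightarrow> nat" where
  "encode_ivl (Bounded lc l u uc) = list_encode [0, of_bool lc, l, u, of_bool uc]"
| "encode_ivl (Unbounded lc l) = list_encode [1, of_bool lc, l]"

primrec encode_mtl :: "nat mtl \<Rightarrow> nat" where
  "encode_mtl TT = list_encode [0]"
| "encode_mtl (Ev \<pi>) = list_encode [1, \<pi>]"
| "encode_mtl (Atom p \<pi>) = list_encode [2, p, \<pi>]"
| "encode_mtl (Conj a b) = list_encode [3, encode_mtl a, encode_mtl b]"
| "encode_mtl (Neg a) = list_encode [4, encode_mtl a]"
| "encode_mtl (Until I a b) = list_encode [5, encode_ivl I, encode_mtl a, encode_mtl b]"
| "encode_mtl (Since I a b) = list_encode [6, encode_ivl I, encode_mtl a, encode_mtl b]"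

primrec encode_hyper :: "nat hypermtl \<Rightarrow> nat" where
  "encode_hyper (Exists \<pi> \<phi>) = list_encode [0, \<pi>, encode_hyper \<phi>]"
| "encode_hyper (Forall \<pi> \<phi>) = list_encode [1, \<pi>, encode_hyper \<phi>]"
| "encode_hyper (Body \<psi>) = list_encode [2, encode_mtl \<psi>]"

definition encode_instance :: "input_ta \<times> nat hypermtl \<Rightarrow> nat" where
  "encode_instance = (\<lambda>(A, \<phi>). list_encode [encode_ta A, encode_hyper \<phi>])"

definition mc_instances ::
    "nat set \<Rightarrow> (nat hypermtl \<Rightarrow> bool) \<Rightarrow> (input_ta \<times> nat hypermtl) set" where
  "mc_instances AP prefix_form =
     {(A, \<phi>). timed_automaton A \<and> alphabet A = Pow AP \<and> closed_hypermtl AP \<phi> \<and> prefix_form \<phi>}"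

definition mc_decidable :: "nat set \<Rightarrow> (nat hypermtl \<Rightarrow> bool) \<Rightarrow> bool" where
  "mc_decidable AP prefix_form \<longleftrightarrow>
     decidable_on encode_instance (mc_instances AP prefix_form) (\<lambda>(A, \<phi>). models (language A) \<phi>)"

lemma encode_ivl_inj: "encode_ivl I = encode_ivl J \<Longrightarrow> I = J"
  by (cases I; cases J) (auto simp: list_encode_eq of_bool_def split: if_splits)

lemma encode_mtl_inj: "encode_mtl a = encode_mtl b \<Longrightarrow> a = b"
  by (induction a arbitrary: b; case_tac b) (auto simp: list_encode_eq dest: encode_ivl_inj)

lemma encode_hyper_inj: "encode_hyper a = encode_hyper b \<Longrightarrow> a = b"
  by (induction a arbitrary: b; case_tac b) (auto simp: list_encode_eq dest: encode_mtl_inj)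

lemma encode_cmp_inj: "encode_cmp c = encode_cmp d \<Longrightarrow> c = d"
  by (cases c; cases d) auto

lemma encode_guard_inj: "encode_guard a = encode_guard b \<Longrightarrow> a = b"
  by (induction a arbitrary: b; case_tac b) (auto simp: list_encode_eq dest: encode_cmp_inj)

lemma encode_trans_inj:
  "inj_on encode_trans {(s, a, g, Y, s'). finite a \<and> finite Y}"
  by (rule inj_onI) (clarsimp simp: encode_trans_def list_encode_eq set_encode_eq encode_guard_inj)

lemma encode_ta_inj:
  assumes A: "timed_automaton A" "alphabet A = Pow AP"
    and B: "timed_automaton B" "alphabet B = Pow AP"
    and AP: "finite AP" and eq: "encode_ta A = encode_ta B"
  shows "A = B"
proof -
  have sub: "trans C \<subseteq> {(s, a, g, Y, s'). finite a \<and> finite Y}"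
    if C: "timed_automaton C" "alphabet C = Pow AP" for C :: input_ta
  proof
    fix \<delta>
    assume \<delta>: "\<delta> \<in> trans C"
    obtain s a g Y s' where eq: "\<delta> = (s, a, g, Y, s')" by (rule prod_cases5)
    have "trans C \<subseteq> locs C \<times> alphabet C \<times> {g. guard_clocks g \<subseteq> clocks C} \<times> Pow (clocks C) \<times> locs C"
      and fin: "finite (clocks C)"
      using C(1) by (simp_all only: timed_automaton_def)
    from subsetD[OF this(1) \<delta>] have "a \<subseteq> AP" "Y \<subseteq> clocks C"
      by (simp_all add: eq C(2))
    then show "\<delta> \<in> {(s, a, g, Y, s'). finite a \<and> finite Y}"
      using AP fin by (simp add: eq finite_subset)
  qed
  have fin: "finite (locs C) \<and> finite (clocks C) \<and> finite (trans C) \<and> finite (accepting C)"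
    if "timed_automaton C" for C :: input_ta
    using that finite_subset[of "accepting C" "locs C"] by (simp only: timed_automaton_def)
  have eqs: "set_encode (locs A) = set_encode (locs B)" "init A = init B"
    "set_encode (clocks A) = set_encode (clocks B)"
    "set_encode (encode_trans ` trans A) = set_encode (encode_trans ` trans B)"
    "set_encode (accepting A) = set_encode (accepting B)"
    using eq unfolding encode_ta_def by (simp_all only: list_encode_eq list.inject)
  have "encode_trans ` trans A = encode_trans ` trans B"
    using eqs(4) fin[OF A(1)] fin[OF B(1)] by (simp only: set_encode_eq finite_imageI)
  then have "trans A = trans B"
    by (simp only: inj_on_image_eq_iff[OF encode_trans_inj sub[OF A] sub[OF B]])
  moreover have "locs A = locs B" "clocks A = clocks B" "accepting A = accepting B"
    using eqs(1,3,5) fin[OF A(1)] fin[OF B(1)] by (simp_all only: set_encode_eq)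
  moreover have "alphabet A = alphabet B" by (simp only: A(2) B(2))
  ultimately show ?thesis
    using eqs(2) by (intro ta.equality) simp_all
qed

lemma encode_instance_inj:
  assumes "finite AP"
  shows "inj_on encode_instance (mc_instances AP prefix_form)"
proof (rule inj_onI, clarify)
  fix A \<phi> B \<psi>
  assume mem: "(A, \<phi>) \<in> mc_instances AP prefix_form" "(B, \<psi>) \<in> mc_instances AP prefix_form"
    and eq: "encode_instance (A, \<phi>) = encode_instance (B, \<psi>)"
  have "encode_ta A = encode_ta B" "encode_hyper \<phi> = encode_hyper \<psi>"
    using eq by (simp_all add: encode_instance_def list_encode_eq)
  then show "A = B \<and> \<phi> = \<psi>"
    using mem assms encode_ta_inj[of A AP B] encode_hyper_inj[of \<phi> \<psi>]
    by (simp add: mc_instances_def)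
qed

end

theory Submission
  imports Defs
begin

text \<open>Only \<open>\<top>\<^sub>\<pi>\<close> literals are used, so a trace is just a finite set of times and the timed automaton may accept
  every timed word. Existential traces describe a run of a register machine; one universal trace \<open>Y\<close>
  restores the punctuality that non-singular intervals lack: ``the last event of \<open>Y\<close> is at distance at least \<open>1\<close>
  but not more than \<open>1\<close>'' says that \<open>Y\<close> ends exactly one time unit later, and since \<open>Y\<close> is
  arbitrary, ``every \<open>x\<close> in \<open>A\<close> has \<open>x + 1\<close> in \<open>B\<close>'' becomes expressible. A run of length \<open>H\<close> is drawn as a grid in
  which register values are integer shifts and successive configurations are successive columns, so an
  increment is a shift by \<open>1\<close> followed by a move to the next grid point.

  If an algorithm decided the problem, a register machine could, given the code of a formula describing a machine,
  ask the algorithm about the instance that runs this very machine on its own code, and do the opposite.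
  The \<open>\<forall>\<^sup>*\<exists>\<^sup>*\<close> problem is the dual one.\<close>

section \<open>Computable functions on natural numbers\<close>

text \<open>Registers with different values are marked in different rows, yet all of them must move
  to the same next column. This works because all rows up to the bound carry the same fractional
  parts, so the nearest later grid point has the same offset whichever row it is taken in. Only two
  one-sided facts about grids are needed. A run that reaches the accepting address yields a finite
  grid. Conversely any grid, possibly with stray marks, contains the genuine run, so a run that
  reaches the rejecting address excludes all grids. As a decider answers on every instance, one of
  the two cases always applies. The self-reference is cheap because the inputs enter as interval
  endpoints in conjuncts of their own. The description of the program is fixed beforehand, its code
  \<open>n\<close> is then a legitimate input, and the code of the whole instance is a simple
  arithmetical function of \<open>n\<close> and the prefix length \<open>m\<close>.\<close>

lemma computes_simps:
  "computes Zero xs y \<longleftrightarrow> y = 0"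
  "computes Succ xs y \<longleftrightarrow> (\<exists>x. xs = [x] \<and> y = Suc x)"
  "computes (Proj i) xs y \<longleftrightarrow> i < length xs \<and> y = xs ! i"
  "computes (Comp f gs) xs y \<longleftrightarrow> (\<exists>ys. list_all2 (\<lambda>g y. computes g xs y) gs ys \<and> computes f ys y)"
  "computes (PrimRec f g) (0 # xs) y \<longleftrightarrow> computes f xs y"
  "computes (PrimRec f g) (Suc n # xs) y \<longleftrightarrow>
    (\<exists>z. computes (PrimRec f g) (n # xs) z \<and> computes g (n # z # xs) y)"
  "\<not> computes (PrimRec f g) [] y"
  "computes (Mu f) xs y \<longleftrightarrow> computes f (y # xs) 0 \<and> (\<forall>m<y. \<exists>k. computes f (m # xs) (Suc k))"
  by (subst computes.simps; auto; fail)+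

definition computable :: "nat \<Rightarrow> (nat list \<Rightarrow> nat) \<Rightarrow> bool" where
  "computable n F \<longleftrightarrow> (\<exists>f. \<forall>xs. length xs = n \<longrightarrow> computes f xs (F xs))"

lemma computable_compose:
  assumes F: "computable (length Gs) F" and Gs: "\<forall>G \<in> set Gs. computable n G"
  shows "computable n (\<lambda>xs. F (map (\<lambda>G. G xs) Gs))"
proof -
  obtain f where f: "\<And>xs. length xs = length Gs \<Longrightarrow> computes f xs (F xs)"
    using F unfolding computable_def by blast
  obtain h where h: "\<And>G xs. G \<in> set Gs \<Longrightarrow> length xs = n \<Longrightarrow> computes (h G) xs (G xs)"
    using Gs unfolding computable_def by metis
  have "computes (Comp f (map h Gs)) xs (F (map (\<lambda>G. G xs) Gs))" if "length xs = n" for xs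
    by (rule computes.comp[where ys = "map (\<lambda>G. G xs) Gs"])
      (auto simp: list_all2_conv_all_nth that intro: h f)
  then show ?thesis unfolding computable_def by blast
qed

lemma computable_nth [intro]: "i < n \<Longrightarrow> computable n (\<lambda>xs. xs ! i)"
  unfolding computable_def by (intro exI[of _ "Proj i"]) (auto intro: computes.proj)

lemma computable_Suc [intro]:
  assumes "computable n F"
  shows "computable n (\<lambda>xs. Suc (F xs))"
proof -
  have "computes Succ ys (Suc (ys ! 0))" if "length ys = 1" for ys
    using that computes.succ by (auto simp: length_Suc_conv)
  then have "computable (length [F]) (\<lambda>xs. Suc (xs ! 0))"
    unfolding computable_def by auto
  from computable_compose[OF this, of n] show ?thesis using assms by simp
qed

lemma computable_const [intro]: "computable n (\<lambda>xs. c)"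
proof (induction c)
  case 0
  show ?case unfolding computable_def by (blast intro: computes.zero)
qed auto

text \<open>\<open>PrimRec\<close> also hands the parameters to its step function, while
  \<open>g\<close> sees only the counter and the previous value; hence \<open>g\<close> is first
  lifted to arity \<open>n + 2\<close>. The counter \<open>H xs\<close> is then supplied by
  composition with projections.\<close>

lemma computable_rec_nat:
  assumes A: "computable n A" and H: "computable n H"
    and g: "computable 2 (\<lambda>xs. g (xs ! 0) (xs ! 1))"
  shows "computable n (\<lambda>xs. rec_nat (A xs) g (H xs))"
proof -
  obtain fA where fA: "\<And>xs. length xs = n \<Longrightarrow> computes fA xs (A xs)"
    using A unfolding computable_def by blast
  have "computable (n + 2) (\<lambda>xs. g (xs ! 0) (xs ! 1))"
    using computable_compose[of "[\<lambda>xs. xs ! 0, \<lambda>xs. xs ! 1]" "\<lambda>xs. g (xs ! 0) (xs ! 1)" "n + 2"] g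
    by (auto simp: numeral_2_eq_2)
  then obtain fg where fg: "\<And>xs. length xs = n + 2 \<Longrightarrow> computes fg xs (g (xs ! 0) (xs ! 1))"
    unfolding computable_def by blast
  have rec: "computes (PrimRec fA fg) (k # xs) (rec_nat (A xs) g k)" if "length xs = n" for k xs
  proof (induction k)
    case 0
    show ?case using fA[OF that] by (auto intro: computes.prim_0)
  next
    case (Suc k)
    show ?case
      using Suc fg[of "k # rec_nat (A xs) g k # xs"] that by (auto intro: computes.prim_Suc)
  qed
  have rec': "computes (PrimRec fA fg) ys (rec_nat (A (tl ys)) g (ys ! 0))" if "length ys = Suc n" for ys
    using that rec by (cases ys) auto
  have "computable (length (H # map (\<lambda>i xs. xs ! i) [0..<n])) (\<lambda>ys. rec_nat (A (tl ys)) g (ys ! 0))"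
    unfolding computable_def using rec' by auto
  from computable_compose[OF this, of n]
  have "computable n (\<lambda>xs. rec_nat (A (map (\<lambda>i. xs ! i) [0..<n])) g (H xs))"
    using H by (simp add: comp_def computable_nth)
  then show ?thesis
    unfolding computable_def by (metis (no_types, lifting) map_nth)
qed

lemma computable_add [intro]:
  assumes "computable n F" "computable n G"
  shows "computable n (\<lambda>xs. F xs + G xs)"
proof -
  have eq: "rec_nat a (\<lambda>_ y. Suc y) b = a + b" for a b :: nat
    by (induction b) auto
  have "computable 2 (\<lambda>xs. Suc (xs ! 1))"
    by (intro computable_Suc computable_nth) simp
  with computable_rec_nat[OF assms, of "\<lambda>_ y. Suc y"]
  have "computable n (\<lambda>xs. rec_nat (F xs) (\<lambda>_ y. Suc y) (G xs))" by blast
  then show ?thesis by (simp only: eq)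
qed

lemma computable_triangle [intro]:
  assumes "computable n F"
  shows "computable n (\<lambda>xs. triangle (F xs))"
proof -
  have eq: "rec_nat 0 (\<lambda>k y. y + Suc k) b = triangle b" for b
    by (induction b) auto
  have "computable 2 (\<lambda>xs. xs ! 1 + Suc (xs ! 0))"
    by (intro computable_add computable_Suc computable_nth) auto
  with computable_rec_nat[OF computable_const assms, of "\<lambda>k y. y + Suc k" 0]
  have "computable n (\<lambda>xs. rec_nat 0 (\<lambda>k y. y + Suc k) (F xs))" by blast
  then show ?thesis by (simp only: eq)
qed

lemma computable_prod_encode [intro]:
  "computable n F \<Longrightarrow> computable n G \<Longrightarrow> computable n (\<lambda>xs. prod_encode (F xs, G xs))"
  by (simp add: prod_encode_def computable_add computable_triangle)

section \<open>Loop programs for partial recursive functions\<close>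

text \<open>\<open>Loop\<close> is a while loop whose test also decrements, which is what a single
  \<open>Dec\<close> instruction does. Its body may refill the register, as the unbounded search for
  \<open>Mu\<close> requires.\<close>

datatype com = Incr nat | Seq com com | Loop nat com

inductive exec :: "com \<Rightarrow> (nat \<Rightarrow> nat) \<Rightarrow> (nat \<Rightarrow> nat) \<Rightarrow> bool" where
  Incr: "exec (Incr r) v (v(r := Suc (v r)))"
| Seq: "exec c v v' \<Longrightarrow> exec d v' v'' \<Longrightarrow> exec (Seq c d) v v''"
| Loop_0: "v r = 0 \<Longrightarrow> exec (Loop r c) v v"
| Loop_Suc: "v r \<noteq> 0 \<Longrightarrow> exec c (v(r := v r - 1)) v' \<Longrightarrow> exec (Loop r c) v' v'' \<Longrightarrow>
    exec (Loop r c) v v''"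

definition clear :: "nat \<Rightarrow> com" where
  "clear r = Loop r (Incr 0)"

lemma exec_clear: "r \<noteq> 0 \<Longrightarrow> \<exists>v'. exec (clear r) v v' \<and> v' r = 0 \<and> (\<forall>x. x \<notin> {0, r} \<longrightarrow> v' x = v x)"
proof (induction "v r" arbitrary: v)
  case 0
  then show ?case unfolding clear_def by (intro exI[of _ v]) (auto intro: exec.Loop_0)
next
  case (Suc n)
  define w where "w = (v(r := v r - 1))(0 := Suc (v 0))"
  have "exec (Incr 0) (v(r := v r - 1)) w"
    using exec.Incr[of 0 "v(r := v r - 1)"] Suc.prems by (simp add: w_def)
  note inc = this
  have "n = w r" using Suc by (auto simp: w_def)
  from Suc.hyps(1)[of w, OF this Suc.prems] obtain v' where
    v': "exec (clear r) w v'" "v' r = 0" "\<forall>x. x \<notin> {0, r} \<longrightarrow> v' x = w x" by blast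
  have "v r \<noteq> 0" using Suc.hyps(2) by simp
  from exec.Loop_Suc[OF this inc v'(1)[unfolded clear_def]]
  have "exec (clear r) v v'" unfolding clear_def .
  moreover have "\<forall>x. x \<notin> {0, r} \<longrightarrow> v' x = v x" using v'(3) by (simp add: w_def)
  ultimately show ?case using v'(2) by blast
qed

text \<open>Reading a register empties it, so the value is drained into \<open>b\<close> and the
  scratch register \<open>t\<close> at once and then poured back from \<open>t\<close>.\<close>

definition copy :: "nat \<Rightarrow> nat \<Rightarrow> nat \<Rightarrow> com" where
  "copy a b t = Seq (Seq (clear b) (clear t)) (Seq (Loop a (Seq (Incr b) (Incr t))) (Loop t (Incr a)))"

lemma exec_split: "distinct [a, b, t] \<Longrightarrow>
  exec (Loop a (Seq (Incr b) (Incr t))) v (v(a := 0, b := v b + v a, t := v t + v a))"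
proof (induction "v a" arbitrary: v)
  case 0
  then have eq: "v(a := 0, b := v b + v a, t := v t + v a) = v" by auto
  show ?case unfolding eq using 0 by (intro exec.Loop_0) simp
next
  case (Suc n)
  let ?u = "v(a := v a - 1)"
  let ?w = "?u(b := Suc (v b), t := Suc (v t))"
  have "exec (Incr b) ?u (?u(b := Suc (v b)))"
    using exec.Incr[of b ?u] Suc.prems by simp
  moreover have "exec (Incr t) (?u(b := Suc (v b))) ?w"
    using exec.Incr[of t "?u(b := Suc (v b))"] Suc.prems by simp
  ultimately have "exec (Seq (Incr b) (Incr t)) ?u ?w" by (rule exec.Seq)
  moreover have "n = ?w a" using Suc by simp
  from Suc.hyps(1)[of ?w, OF this Suc.prems]
  have "exec (Loop a (Seq (Incr b) (Incr t))) ?w (?w(a := 0, b := ?w b + ?w a, t := ?w t + ?w a))" .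
  moreover have "?w(a := 0, b := ?w b + ?w a, t := ?w t + ?w a) = v(a := 0, b := v b + v a, t := v t + v a)"
    using Suc by auto
  ultimately show ?case using Suc.hyps(2) by (auto intro: exec.Loop_Suc)
qed

lemma exec_move: "a \<noteq> t \<Longrightarrow> exec (Loop t (Incr a)) v (v(t := 0, a := v a + v t))"
proof (induction "v t" arbitrary: v)
  case 0
  then have eq: "v(t := 0, a := v a + v t) = v" by auto
  show ?case unfolding eq using 0 by (intro exec.Loop_0) simp
next
  case (Suc n)
  let ?u = "v(t := v t - 1)"
  let ?w = "?u(a := Suc (v a))"
  have "exec (Incr a) ?u ?w"
    using exec.Incr[of a ?u] Suc.prems by simp
  moreover have "n = ?w t" using Suc by simp
  from Suc.hyps(1)[of ?w, OF this Suc.prems]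
  have "exec (Loop t (Incr a)) ?w (?w(t := 0, a := ?w a + ?w t))" .
  moreover have "?w(t := 0, a := ?w a + ?w t) = v(t := 0, a := v a + v t)"
    using Suc by auto
  ultimately show ?case using Suc.hyps(2) by (auto intro: exec.Loop_Suc)
qed

lemma exec_copy:
  assumes "distinct [0, a, b, t]"
  shows "\<exists>v'. exec (copy a b t) v v' \<and> v' b = v a \<and> (\<forall>x. x \<notin> {0, b, t} \<longrightarrow> v' x = v x)"
proof -
  obtain v1 where v1: "exec (clear b) v v1" "v1 b = 0" "\<forall>x. x \<notin> {0, b} \<longrightarrow> v1 x = v x"
    using exec_clear[of b v] assms by auto
  obtain v2 where v2: "exec (clear t) v1 v2" "v2 t = 0" "\<forall>x. x \<notin> {0, t} \<longrightarrow> v2 x = v1 x"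
    using exec_clear[of t v1] assms by auto
  let ?v3 = "v2(a := 0, b := v2 b + v2 a, t := v2 t + v2 a)"
  let ?v4 = "?v3(t := 0, a := ?v3 a + ?v3 t)"
  have "exec (copy a b t) v ?v4"
    unfolding copy_def using assms
    by (intro exec.Seq[OF exec.Seq[OF v1(1) v2(1)]] exec.Seq[OF exec_split exec_move]) auto
  then show ?thesis
    using assms v1 v2 by (intro exI[of _ ?v4]) auto
qed

section \<open>Compiling partial recursive functions into loop programs\<close>

text \<open>Register \<open>0\<close> is a dump: it absorbs the increments of the otherwise empty loop bodies of \<^const>\<open>clear\<close>.\<close>

definition realizes :: "com \<Rightarrow> recf \<Rightarrow> nat list \<Rightarrow> nat \<Rightarrow> nat \<Rightarrow> bool" where
  "realizes c f as o' s \<longleftrightarrow> (\<forall>v y. computes f (map v as) y \<longrightarrow>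
     (\<exists>v'. exec c v v' \<and> v' o' = y \<and> (\<forall>r < s. r \<noteq> o' \<and> r \<noteq> 0 \<longrightarrow> v' r = v r)))"

text \<open>For \<open>Comp\<close>, the values are placed side by side from register
  \<open>l\<close> on. Apart from its output and the dump, each program touches only registers from
  \<open>s\<close> on, so it spoils neither the arguments nor the results already stored.\<close>

lemma realizes_list:
  assumes "\<forall>g \<in> set gs. \<forall>o'. o' \<noteq> 0 \<and> o' < s \<and> o' \<notin> set as \<longrightarrow> (\<exists>c. realizes c g as o' s)"
    and "0 < l" "\<forall>a \<in> set as. 0 < a \<and> a < l" "l + length gs \<le> s"
  shows "\<exists>c. \<forall>v ys. list_all2 (\<lambda>g y. computes g (map v as) y) gs ys \<longrightarrow>
    (\<exists>v'. exec c v v' \<and> map v' [l..<l + length gs] = ys \<and> (\<forall>r < l. r \<noteq> 0 \<longrightarrow> v' r = v r))"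
  using assms
proof (induction gs arbitrary: l)
  case Nil
  have "exec (Incr 0) v (v(0 := Suc (v 0)))" for v by (rule exec.Incr)
  then have "\<exists>v'. exec (Incr 0) v v' \<and> (\<forall>r < l. r \<noteq> 0 \<longrightarrow> v' r = v r)" for v
    by (intro exI[of _ "v(0 := Suc (v 0))"]) simp
  then show ?case by (intro exI[of _ "Incr 0"]) simp
next
  case (Cons g gs)
  have "l \<noteq> 0 \<and> l < s \<and> l \<notin> set as" using Cons.prems by auto
  then obtain c where c: "realizes c g as l s"
    using Cons.prems(1) by (meson list.set_intros(1))
  have "\<exists>c. \<forall>v ys. list_all2 (\<lambda>g y. computes g (map v as) y) gs ys \<longrightarrow>
    (\<exists>v'. exec c v v' \<and> map v' [Suc l..<Suc l + length gs] = ys \<and> (\<forall>r < Suc l. r \<noteq> 0 \<longrightarrow> v' r = v r))"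
  proof (rule Cons.IH)
    show "\<forall>a \<in> set as. 0 < a \<and> a < Suc l" using Cons.prems(3) less_SucI by blast
  qed (use Cons.prems in auto)
  then obtain d where d: "\<And>v ys. list_all2 (\<lambda>g y. computes g (map v as) y) gs ys \<Longrightarrow>
    \<exists>v'. exec d v v' \<and> map v' [Suc l..<Suc l + length gs] = ys \<and> (\<forall>r < Suc l. r \<noteq> 0 \<longrightarrow> v' r = v r)"
    by blast
  have "\<exists>v'. exec (Seq c d) v v' \<and> map v' [l..<l + length (g # gs)] = ys \<and> (\<forall>r < l. r \<noteq> 0 \<longrightarrow> v' r = v r)"
    if ys: "list_all2 (\<lambda>g y. computes g (map v as) y) (g # gs) ys" for v ys
  proof -
    obtain y zs where yz: "ys = y # zs" "computes g (map v as) y"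
      "list_all2 (\<lambda>g y. computes g (map v as) y) gs zs"
      using ys by (auto simp: list_all2_Cons1)
    obtain v1 where v1: "exec c v v1" "v1 l = y" "\<forall>r < s. r \<noteq> l \<and> r \<noteq> 0 \<longrightarrow> v1 r = v r"
      using c yz(2) unfolding realizes_def by blast
    have "map v1 as = map v as"
      using v1(3) Cons.prems(3,4) by auto
    then have "list_all2 (\<lambda>g y. computes g (map v1 as) y) gs zs" using yz(3) by (simp only:)
    then obtain v2 where v2: "exec d v1 v2" "map v2 [Suc l..<Suc l + length gs] = zs"
      "\<forall>r < Suc l. r \<noteq> 0 \<longrightarrow> v2 r = v1 r"
      using d by blast
    have "v2 l = y" using v2(3) v1(2) Cons.prems(2) by simp
    moreover have "[l..<l + length (g # gs)] = l # [Suc l..<Suc l + length gs]"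
      by (simp add: upt_conv_Cons del: upt_Suc)
    ultimately have "map v2 [l..<l + length (g # gs)] = ys"
      using v2(2) yz(1) by (simp del: upt_Suc)
    moreover have "\<forall>r < l. r \<noteq> 0 \<longrightarrow> v2 r = v r"
      using v1(3) v2(3) Cons.prems(4) by simp
    ultimately show ?thesis
      using exec.Seq[OF v1(1) v2(1)] by blast
  qed
  then show ?case by (intro exI[of _ "Seq c d"]) simp
qed

text \<open>Registers from \<open>s\<close> on are scratch space. The induction generalises
  \<open>s\<close>, so that subprograms are compiled with a larger \<open>s\<close> and leave alone
  the counters and intermediate results kept just above the old one.\<close>

lemma realizes_exists:
  "o' \<noteq> 0 \<Longrightarrow> o' < s \<Longrightarrow> o' \<notin> set as \<Longrightarrow> \<forall>a \<in> set as. 0 < a \<and> a < s \<Longrightarrow> \<exists>c. realizes c f as o' s"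
proof (induction f arbitrary: as o' s)
  case Zero
  have "realizes (clear o') Zero as o' s"
    unfolding realizes_def computes_simps
  proof (intro allI impI)
    fix v :: "nat \<Rightarrow> nat" and y :: nat
    assume "y = 0"
    then show "\<exists>v'. exec (clear o') v v' \<and> v' o' = y \<and> (\<forall>r < s. r \<noteq> o' \<and> r \<noteq> 0 \<longrightarrow> v' r = v r)"
      using exec_clear[OF Zero.prems(1), of v] by auto
  qed
  then show ?case by blast
next
  case Succ
  have "realizes (Seq (copy (hd as) o' s) (Incr o')) Succ as o' s"
    unfolding realizes_def
  proof (intro allI impI)
    fix v y
    assume "computes Succ (map v as) y"
    then obtain a where a: "as = [a]" "y = Suc (v a)"
      by (auto simp: computes_simps map_eq_Cons_conv)
    have "distinct [0, a, o', s]" using Succ.prems a by auto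
    from exec_copy[OF this, of v] obtain v' where v': "exec (copy a o' s) v v'" "v' o' = v a"
      "\<forall>x. x \<notin> {0, o', s} \<longrightarrow> v' x = v x" by blast
    show "\<exists>v'. exec (Seq (copy (hd as) o' s) (Incr o')) v v' \<and> v' o' = y \<and>
      (\<forall>r < s. r \<noteq> o' \<and> r \<noteq> 0 \<longrightarrow> v' r = v r)"
      using exec.Seq[OF v'(1) exec.Incr[of o']] v' a by (intro exI[of _ "v'(o' := Suc (v' o'))"]) simp
  qed
  then show ?case by blast
next
  case (Proj i)
  have "realizes (copy (as ! i) o' s) (Proj i) as o' s"
    unfolding realizes_def
  proof (intro allI impI)
    fix v y
    assume "computes (Proj i) (map v as) y"
    then have i: "i < length as" "y = v (as ! i)"
      by (auto simp: computes_simps)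
    have "distinct [0, as ! i, o', s]" using Proj.prems i(1) nth_mem[OF i(1)] by auto
    from exec_copy[OF this, of v] obtain v' where "exec (copy (as ! i) o' s) v v'"
      "v' o' = v (as ! i)" "\<forall>x. x \<notin> {0, o', s} \<longrightarrow> v' x = v x" by blast
    then show "\<exists>v'. exec (copy (as ! i) o' s) v v' \<and> v' o' = y \<and>
      (\<forall>r < s. r \<noteq> o' \<and> r \<noteq> 0 \<longrightarrow> v' r = v r)"
      using i(2) by (intro exI[of _ v']) simp
  qed
  then show ?case by blast
next
  case (Comp f gs)
  let ?t = "s + length gs"
  have "\<forall>g \<in> set gs. \<forall>o'. o' \<noteq> 0 \<and> o' < ?t \<and> o' \<notin> set as \<longrightarrow> (\<exists>c. realizes c g as o' ?t)"
  proof (intro ballI allI impI)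
    fix g o1
    assume "g \<in> set gs" "o1 \<noteq> 0 \<and> o1 < ?t \<and> o1 \<notin> set as"
    then show "\<exists>c. realizes c g as o1 ?t" using Comp.prems(4) by (intro Comp.IH(2)) auto
  qed
  moreover have "0 < s" using Comp.prems by simp
  ultimately obtain c where c:
    "\<And>v ys. list_all2 (\<lambda>g y. computes g (map v as) y) gs ys \<Longrightarrow>
      \<exists>v'. exec c v v' \<and> map v' [s..<?t] = ys \<and> (\<forall>r < s. r \<noteq> 0 \<longrightarrow> v' r = v r)"
    using realizes_list[of gs ?t as s] Comp.prems(4) by blast
  have "\<exists>d. realizes d f [s..<?t] o' ?t"
    by (rule Comp.IH(1)) (use Comp.prems in auto)
  then obtain d where d: "realizes d f [s..<?t] o' ?t" by blast
  have "realizes (Seq c d) (Comp f gs) as o' s"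
    unfolding realizes_def
  proof (intro allI impI)
    fix v y
    assume "computes (Comp f gs) (map v as) y"
    then obtain ys where ys: "list_all2 (\<lambda>g y. computes g (map v as) y) gs ys" "computes f ys y"
      by (auto simp: computes_simps)
    from c[OF ys(1)] obtain v1 where v1: "exec c v v1" "map v1 [s..<?t] = ys"
      "\<forall>r < s. r \<noteq> 0 \<longrightarrow> v1 r = v r" by blast
    obtain v2 where v2: "exec d v1 v2" "v2 o' = y" "\<forall>r < ?t. r \<noteq> o' \<and> r \<noteq> 0 \<longrightarrow> v2 r = v1 r"
      using d ys(2) v1(2) unfolding realizes_def by blast
    then show "\<exists>v'. exec (Seq c d) v v' \<and> v' o' = y \<and> (\<forall>r < s. r \<noteq> o' \<and> r \<noteq> 0 \<longrightarrow> v' r = v r)"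
      using v1 by (intro exI[of _ v2]) (auto intro: exec.Seq)
  qed
  then show ?case by blast
next
  case (PrimRec f g)
  show ?case
  proof (cases as)
    case Nil
    \<comment> \<open>\<open>PrimRec\<close> has no value on the empty argument list, so any program
      will do.\<close>
    then have "realizes (clear o') (PrimRec f g) as o' s"
      unfolding realizes_def by (simp add: computes_simps)
    then show ?thesis by blast
  next
    case (Cons a bs)
    have "\<exists>c. realizes c f bs o' (s + 3)"
      by (rule PrimRec.IH(1)) (use PrimRec.prems Cons in auto)
    then obtain cf where cf: "realizes cf f bs o' (s + 3)" by blast
    have "\<exists>c. realizes c g (Suc s # (s + 2) # bs) o' (s + 3)"
      by (rule PrimRec.IH(2)) (use PrimRec.prems Cons in auto)
    then obtain cg where cg: "realizes cg g (Suc s # (s + 2) # bs) o' (s + 3)" by blast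
    define body where "body = Seq (copy o' (s + 2) (s + 3)) (Seq cg (Incr (Suc s)))"
    \<comment> \<open>Invariant: register \<open>s\<close> counts the steps left,
      \<open>Suc s\<close> the steps done, and \<open>o'\<close> holds the value of the recursion
      after \<open>v (Suc s)\<close> steps.\<close>
    have loop: "\<exists>v'. exec (Loop s body) v v' \<and> v' o' = z \<and> (\<forall>r < s. r \<noteq> o' \<and> r \<noteq> 0 \<longrightarrow> v' r = v r)"
      if "computes (PrimRec f g) (v (Suc s) # map v bs) (v o')"
        "computes (PrimRec f g) ((v (Suc s) + v s) # map v bs) z" for v z
      using that
    proof (induction "v s" arbitrary: v)
      case 0
      then have "v o' = z" using computes_deterministic by fastforce
      then show ?case using 0 by (intro exI[of _ v]) (auto intro: exec.Loop_0)
    next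
      case (Suc n)
      let ?u = "v(s := v s - 1)"
      have "distinct [0, o', s + 2, s + 3]" using PrimRec.prems by auto
      from exec_copy[OF this, of ?u] obtain v1 where v1: "exec (copy o' (s + 2) (s + 3)) ?u v1"
        "v1 (s + 2) = v o'" "\<forall>x. x \<notin> {0, s + 2, s + 3} \<longrightarrow> v1 x = ?u x"
        using PrimRec.prems by auto
      have bs: "map v1 bs = map v bs"
        using v1(3) PrimRec.prems Cons by auto
      \<comment> \<open>Definedness at the final count descends to the next count, since each value
        is computed from the preceding one.\<close>
      have "\<exists>y. computes (PrimRec f g) (Suc (v (Suc s)) # map v bs) y"
        if "computes (PrimRec f g) ((Suc (v (Suc s)) + l) # map v bs) y" for l y
        using that
      proof (induction l arbitrary: y)
        case (Suc l)
        then show ?case unfolding add_Suc_right computes_simps(6) by blast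
      qed auto
      moreover have "v (Suc s) + v s = Suc (v (Suc s)) + n"
        using Suc.hyps(2) by simp
      ultimately obtain y where y: "computes (PrimRec f g) (Suc (v (Suc s)) # map v bs) y"
        using Suc.prems(2) by metis
      then have "computes g (v (Suc s) # v o' # map v bs) y"
        using Suc.prems(1) computes_deterministic unfolding computes_simps(6) by blast
      moreover have "v1 (Suc s) = v (Suc s)" using v1(3) PrimRec.prems by auto
      ultimately have "computes g (map v1 (Suc s # (s + 2) # bs)) y"
        using v1(2) by (simp only: list.map bs)
      then obtain v2 where v2: "exec cg v1 v2" "v2 o' = y" "\<forall>r < s + 3. r \<noteq> o' \<and> r \<noteq> 0 \<longrightarrow> v2 r = v1 r"
        using cg unfolding realizes_def by blast
      define v3 where "v3 = v2(Suc s := Suc (v2 (Suc s)))"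
      have ex: "exec body ?u v3"
        unfolding body_def v3_def by (intro exec.Seq[OF v1(1)] exec.Seq[OF v2(1)] exec.Incr)
      have v3: "v3 s = n" "v3 (Suc s) = Suc (v (Suc s))" "v3 o' = y"
        "\<forall>r < s. r \<noteq> o' \<and> r \<noteq> 0 \<longrightarrow> v3 r = v r"
        using v1(3) v2 Suc.hyps(2)[symmetric] PrimRec.prems(1,2) by (auto simp: v3_def)
      have v3_bs: "map v3 bs = map v bs"
      proof (rule map_cong[OF refl])
        fix x
        assume "x \<in> set bs"
        then have "x < s \<and> x \<noteq> o' \<and> x \<noteq> 0" using PrimRec.prems(3,4) Cons by auto
        then show "v3 x = v x" using v3(4) by blast
      qed
      have "\<exists>v'. exec (Loop s body) v3 v' \<and> v' o' = z \<and> (\<forall>r < s. r \<noteq> o' \<and> r \<noteq> 0 \<longrightarrow> v' r = v3 r)"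
        using Suc.hyps(1)[of v3] v3 v3_bs y Suc.prems(2) Suc.hyps(2)[symmetric] by (simp del: map_eq_conv)
      then obtain v' where "exec (Loop s body) v3 v'" "v' o' = z"
        "\<forall>r < s. r \<noteq> o' \<and> r \<noteq> 0 \<longrightarrow> v' r = v3 r" by blast
      then show ?case
        using exec.Loop_Suc[OF _ ex] Suc.hyps(2) v3(4) by (intro exI[of _ v']) auto
    qed
    have "realizes (Seq (copy a s (s + 3)) (Seq (clear (Suc s)) (Seq cf (Loop s body)))) (PrimRec f g) as o' s"
      unfolding realizes_def
    proof (intro allI impI)
      fix v z
      assume z: "computes (PrimRec f g) (map v as) z"
      have "distinct [0, a, s, s + 3]" using PrimRec.prems Cons by auto
      from exec_copy[OF this, of v] obtain v1 where v1: "exec (copy a s (s + 3)) v v1"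
        "v1 s = v a" "\<forall>x. x \<notin> {0, s, s + 3} \<longrightarrow> v1 x = v x" by blast
      obtain v2 where v2: "exec (clear (Suc s)) v1 v2" "v2 (Suc s) = 0" "\<forall>x. x \<notin> {0, Suc s} \<longrightarrow> v2 x = v1 x"
        using exec_clear[of "Suc s" v1] by auto
      have bs: "map v2 bs = map v bs" using v1 v2 PrimRec.prems Cons by auto
      have "\<exists>y. computes f (map v bs) y" if "computes (PrimRec f g) (k # map v bs) y" for k y
        using that by (induction k arbitrary: y) (auto simp: computes_simps)
      from this[of "v a" z] z Cons obtain y where y: "computes f (map v bs) y" by auto
      then obtain v3 where v3: "exec cf v2 v3" "v3 o' = y" "\<forall>r < s + 3. r \<noteq> o' \<and> r \<noteq> 0 \<longrightarrow> v3 r = v2 r"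
        using cf bs unfolding realizes_def by metis
      have "map v3 bs = map v2 bs"
      proof (rule map_cong[OF refl])
        fix x
        assume "x \<in> set bs"
        then have "x < s + 3 \<and> x \<noteq> o' \<and> x \<noteq> 0" using PrimRec.prems(3,4) Cons by auto
        then show "v3 x = v2 x" using v3(3) by blast
      qed
      with bs have bs3: "map v3 bs = map v bs" by (simp only:)
      have "v3 s = v a" "v3 (Suc s) = 0"
        using v1 v2 v3 PrimRec.prems by auto
      then obtain v' where v': "exec (Loop s body) v3 v'" "v' o' = z"
        "\<forall>r < s. r \<noteq> o' \<and> r \<noteq> 0 \<longrightarrow> v' r = v3 r"
        using loop[of v3 z] bs3 v3(2) y z Cons by (auto intro: computes.prim_0 simp del: map_eq_conv)
      then show "\<exists>v'. exec (Seq (copy a s (s + 3)) (Seq (clear (Suc s)) (Seq cf (Loop s body)))) v v' \<and>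
          v' o' = z \<and> (\<forall>r < s. r \<noteq> o' \<and> r \<noteq> 0 \<longrightarrow> v' r = v r)"
        using exec.Seq[OF v1(1) exec.Seq[OF v2(1) exec.Seq[OF v3(1) v'(1)]]] v1(3) v2(3) v3(3)
        by (intro exI[of _ v']) auto
    qed
    then show ?thesis by blast
  qed
next
  case (Mu f)
  have "\<exists>c. realizes c f (o' # as) s (Suc s)"
    by (rule Mu.IH) (use Mu.prems in auto)
  then obtain c where c: "realizes c f (o' # as) s (Suc s)" by blast
  have run_c: "\<exists>v'. exec c v v' \<and> v' s = y \<and> (\<forall>r < s. r \<noteq> 0 \<longrightarrow> v' r = v r)"
    if "computes f (v o' # map v as) y" for v y
  proof -
    have "computes f (map v (o' # as)) y" using that by simp
    with c obtain v' where "exec c v v'" "v' s = y" "\<forall>r < Suc s. r \<noteq> s \<and> r \<noteq> 0 \<longrightarrow> v' r = v r"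
      unfolding realizes_def by blast
    then show ?thesis by (intro exI[of _ v']) simp
  qed
  define body where "body = Seq (Incr o') c"
  \<comment> \<open>Register \<open>o'\<close> is the candidate and \<open>s\<close> holds the value
    of \<open>f\<close> at it. The loop test spoils a nonzero value, but the body recomputes it for
    the next candidate.\<close>
  have loop: "\<exists>v'. exec (Loop s body) v v' \<and> v' o' = n \<and> (\<forall>r < s. r \<noteq> o' \<and> r \<noteq> 0 \<longrightarrow> v' r = v r)"
    if "computes (Mu f) (map v as) n" "computes f (v o' # map v as) (v s)" "v o' \<le> n" for v n
    using that
  proof (induction "n - v o'" arbitrary: v)
    case 0
    then have "v o' = n" by simp
    with 0(2,3) have "v s = 0" using computes_deterministic unfolding computes_simps(8) by blast
    then show ?case using \<open>v o' = n\<close> by (intro exI[of _ v]) (auto intro: exec.Loop_0)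
  next
    case (Suc d)
    then have lt: "v o' < n" by simp
    with Suc.prems(1,2) have pos: "v s \<noteq> 0"
      using computes_deterministic unfolding computes_simps(8) by fastforce
    let ?u = "v(s := v s - 1, o' := Suc (v o'))"
    have u_as: "map ?u as = map v as" using Mu.prems by auto
    obtain y where y: "computes f (Suc (v o') # map v as) y"
    proof (cases "Suc (v o') = n")
      case True
      then show ?thesis using Suc.prems(1) that unfolding computes_simps(8) by blast
    next
      case False
      with lt have "Suc (v o') < n" by simp
      then show ?thesis using Suc.prems(1) that unfolding computes_simps(8) by blast
    qed
    then obtain v1 where v1: "exec c ?u v1" "v1 s = y" "\<forall>r < s. r \<noteq> 0 \<longrightarrow> v1 r = ?u r"
      using run_c[of ?u y] u_as Mu.prems by (auto simp del: map_eq_conv)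
    have v1_as: "map v1 as = map v as" using v1(3) Mu.prems by auto
    have v1_o: "v1 o' = Suc (v o')" using v1(3) Mu.prems by auto
    have inc: "exec (Incr o') (v(s := v s - 1)) ?u"
      using exec.Incr[of o' "v(s := v s - 1)"] Mu.prems by simp
    have "exec body (v(s := v s - 1)) v1"
      unfolding body_def using inc v1(1) by (rule exec.Seq)
    moreover have "\<exists>v'. exec (Loop s body) v1 v' \<and> v' o' = n \<and> (\<forall>r < s. r \<noteq> o' \<and> r \<noteq> 0 \<longrightarrow> v' r = v1 r)"
      using Suc.hyps(1)[of v1] Suc.hyps(2) Suc.prems(1) v1_as v1_o y v1(2) lt by (simp del: map_eq_conv)
    then obtain v' where "exec (Loop s body) v1 v'" "v' o' = n"
      "\<forall>r < s. r \<noteq> o' \<and> r \<noteq> 0 \<longrightarrow> v' r = v1 r" by blast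
    ultimately show ?case
      using exec.Loop_Suc[of v s, OF pos] v1(3) by (intro exI[of _ v']) auto
  qed
  have "realizes (Seq (clear o') (Seq c (Loop s body))) (Mu f) as o' s"
    unfolding realizes_def
  proof (intro allI impI)
    fix v n
    assume n: "computes (Mu f) (map v as) n"
    obtain v1 where v1: "exec (clear o') v v1" "v1 o' = 0" "\<forall>x. x \<notin> {0, o'} \<longrightarrow> v1 x = v x"
      using exec_clear[of o' v] Mu.prems by auto
    have as1: "map v1 as = map v as" using v1(3) Mu.prems by auto
    obtain y where y: "computes f (0 # map v as) y"
      using n unfolding computes_simps(8) by (cases n) auto
    then obtain v2 where v2: "exec c v1 v2" "v2 s = y" "\<forall>r < s. r \<noteq> 0 \<longrightarrow> v2 r = v1 r"
      using run_c[of v1 y] as1 v1(2) by (auto simp del: map_eq_conv)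
    have as2: "map v2 as = map v as" and "v2 o' = 0" using v1(3) v2(3) v1(2) Mu.prems by auto
    then obtain v' where v': "exec (Loop s body) v2 v'" "v' o' = n"
      "\<forall>r < s. r \<noteq> o' \<and> r \<noteq> 0 \<longrightarrow> v' r = v2 r"
      using loop[of v2 n] y v2(2) n by (auto simp del: map_eq_conv)
    then show "\<exists>v'. exec (Seq (clear o') (Seq c (Loop s body))) v v' \<and> v' o' = n \<and>
        (\<forall>r < s. r \<noteq> o' \<and> r \<noteq> 0 \<longrightarrow> v' r = v r)"
      using exec.Seq[OF v1(1) exec.Seq[OF v2(1) v'(1)]] v1(3) v2(3)
      by (intro exI[of _ v']) auto
  qed
  then show ?case by blast
qed

section \<open>Register machines\<close>

datatype instr = Inc nat nat | Dec nat nat nat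

text \<open>Every address outside the program is a halting one; two of them are used,
  \<open>length P\<close> for acceptance and \<open>Suc (length P)\<close> for rejection.\<close>

fun step :: "instr list \<Rightarrow> nat \<times> (nat \<Rightarrow> nat) \<Rightarrow> nat \<times> (nat \<Rightarrow> nat)" where
  "step P (p, v) = (if p < length P then case P ! p of
       Inc k q \<Rightarrow> (q, v(k := Suc (v k)))
     | Dec k q0 q1 \<Rightarrow> if v k = 0 then (q0, v) else (q1, v(k := v k - 1))
     else (p, v))"

primrec code_size :: "com \<Rightarrow> nat" where
  "code_size (Incr r) = 1"
| "code_size (Seq c d) = code_size c + code_size d"
| "code_size (Loop r c) = Suc (code_size c)"

text \<open>\<open>p\<close> is the address of the first instruction and \<open>q\<close> the
  address to continue at; the body of a loop continues at the loop test \<open>p\<close>.\<close>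

primrec assemble :: "com \<Rightarrow> nat \<Rightarrow> nat \<Rightarrow> instr list" where
  "assemble (Incr r) p q = [Inc r q]"
| "assemble (Seq c d) p q = assemble c p (p + code_size c) @ assemble d (p + code_size c) q"
| "assemble (Loop r c) p q = Dec r q (Suc p) # assemble c (Suc p) p"

lemma length_assemble [simp]: "length (assemble c p q) = code_size c"
  by (induction c arbitrary: p q) auto

lemma steps_assemble:
  "exec c v v' \<Longrightarrow> P = pre @ assemble c (length pre) q @ post \<Longrightarrow>
    \<exists>n. (step P ^^ n) (length pre, v) = (q, v')"
proof (induction arbitrary: pre q post rule: exec.induct)
  case (Incr r v)
  then have "step P (length pre, v) = (q, v(r := Suc (v r)))" by simp
  then show ?case by (intro exI[of _ "Suc 0"]) (simp only: funpow.simps comp_def id_apply)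
next
  case (Seq c v v' d v'')
  let ?m = "length pre + code_size c"
  obtain n1 where n1: "(step P ^^ n1) (length pre, v) = (?m, v')"
    using Seq.IH(1)[of pre ?m "assemble d ?m q @ post"] Seq.prems by auto
  obtain n2 where n2: "(step P ^^ n2) (?m, v') = (q, v'')"
    using Seq.IH(2)[of "pre @ assemble c (length pre) ?m" q post] Seq.prems by auto
  show ?case using n1 n2 by (intro exI[of _ "n2 + n1"]) (simp add: funpow_add)
next
  case (Loop_0 v r c)
  then have "step P (length pre, v) = (q, v)" by simp
  then show ?case by (intro exI[of _ 1]) simp
next
  case (Loop_Suc v r c v' v'')
  have 1: "step P (length pre, v) = (Suc (length pre), v(r := v r - 1))"
    using Loop_Suc.hyps Loop_Suc.prems by simp
  have "\<exists>n. (step P ^^ n) (length (pre @ [Dec r q (Suc (length pre))]), v(r := v r - 1)) = (length pre, v')"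
    by (rule Loop_Suc.IH(1)[where post = post]) (simp add: Loop_Suc.prems)
  then obtain n1 where n1: "(step P ^^ n1) (Suc (length pre), v(r := v r - 1)) = (length pre, v')"
    by auto
  obtain n2 where n2: "(step P ^^ n2) (length pre, v') = (q, v'')"
    using Loop_Suc.IH(2)[of pre q post] Loop_Suc.prems by auto
  have "(step P ^^ (n2 + Suc n1)) (length pre, v) = (q, v'')"
    by (simp only: funpow_add comp_def funpow_Suc_right 1 n1 n2)
  then show ?case by blast
qed

primrec regs :: "instr \<Rightarrow> nat set" where
  "regs (Inc k q) = {k}"
| "regs (Dec k q0 q1) = {k}"

primrec targets :: "instr \<Rightarrow> nat set" where
  "targets (Inc k q) = {q}"
| "targets (Dec k q0 q1) = {q0, q1}"

lemma targets_assemble: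
  "i \<in> set (assemble c p q) \<Longrightarrow> 0 < p \<Longrightarrow> 0 < q \<Longrightarrow> 0 \<notin> targets i"
  by (induction c arbitrary: p q) fastforce+

definition input :: "nat \<Rightarrow> nat \<Rightarrow> nat \<Rightarrow> nat" where
  "input m b = (\<lambda>_. 0)(1 := m, 2 := b)"

lemma machine_for_recf:
  "\<exists>P. P \<noteq> [] \<and> (\<forall>i \<in> set P. 0 \<notin> targets i) \<and>
    (\<forall>m b y. computes g [m, b] y \<longrightarrow> (\<exists>n. fst ((step P ^^ n) (0, input m b)) =
      (if y = 0 then length P else Suc (length P))))"
proof -
  obtain c where c: "realizes c g [1, 2] 3 4"
    using realizes_exists[of 3 4 "[1, 2]" g] by auto
  let ?L = "Suc (code_size c)"
  \<comment> \<open>The leading \<open>Inc\<close> on the dump register is an entry that no jump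
    returns to, even if the compiled code begins with a loop. The final \<open>Dec\<close> sends
    output \<open>0\<close> to the address \<open>length P\<close> and any other output to the
    address after it.\<close>
  define P where "P = Inc 0 1 # assemble c 1 ?L @ [Dec 3 (Suc ?L) (Suc (Suc ?L))]"
  have len: "length P = Suc ?L" by (simp add: P_def)
  have "\<exists>n. fst ((step P ^^ n) (0, input m b)) = (if y = 0 then length P else Suc (length P))"
    if y: "computes g [m, b] y" for m b y
  proof -
    let ?v = "(input m b)(0 := 1)"
    have 1: "step P (0, input m b) = (1, ?v)" by (simp add: P_def input_def)
    have "computes g (map ?v [1, 2]) y" using y by (simp add: input_def)
    then obtain v' where v': "exec c ?v v'" "v' 3 = y" using c unfolding realizes_def by blast
    obtain n where n: "(step P ^^ n) (1, ?v) = (?L, v')"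
      using steps_assemble[OF v'(1), of P "[Inc 0 1]"] by (auto simp: P_def)
    have 2: "P ! ?L = Dec 3 (Suc ?L) (Suc (Suc ?L))"
      by (simp add: P_def nth_append)
    have "fst (step P (?L, v')) = (if y = 0 then length P else Suc (length P))"
      using 2 v'(2) by (simp add: len)
    moreover have "(step P ^^ (Suc (Suc n))) (0, input m b) = step P (?L, v')"
      by (subst funpow.simps(2), subst funpow_Suc_right) (simp only: comp_def 1 n)
    ultimately show ?thesis by metis
  qed
  moreover have "\<forall>i \<in> set P. 0 \<notin> targets i"
    using targets_assemble by (auto simp: P_def)
  moreover have "P \<noteq> []" by (simp add: P_def)
  ultimately show ?thesis by blast
qed

section \<open>Atom-free formulas over finite sets of times\<close>

definition time_sets :: "real set set" where
  "time_sets = {S. finite S \<and> S \<subseteq> {0..}}"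

lemma times_timed_words: "times ` timed_words (Pow AP) = time_sets"
proof (intro equalityI subsetI)
  fix S
  assume S: "S \<in> time_sets"
  define \<rho> where "\<rho> = map (\<lambda>t. ({} :: 'a set, t)) (sorted_list_of_set S)"
  have [simp]: "finite S" "\<forall>t \<in> S. 0 \<le> t" using S by (auto simp: time_sets_def)
  have "map snd \<rho> = sorted_list_of_set S" by (simp add: \<rho>_def comp_def)
  then have "\<rho> \<in> timed_words (Pow AP)" "times \<rho> = S"
    by (auto simp: timed_words_def times_def \<rho>_def image_image)
  then show "S \<in> times ` timed_words (Pow AP)" by blast
qed (auto simp: timed_words_def times_def time_sets_def)

primrec ssat :: "(tvar \<Rightarrow> real set) \<Rightarrow> real set \<Rightarrow> real \<Rightarrow> 'p mtl \<Rightarrow> bool" where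
  "ssat E U t TT \<longleftrightarrow> t \<in> U"
| "ssat E U t (Ev x) \<longleftrightarrow> t \<in> E x"
| "ssat E U t (Atom p x) \<longleftrightarrow> False"
| "ssat E U t (Conj a b) \<longleftrightarrow> ssat E U t a \<and> ssat E U t b"
| "ssat E U t (Neg a) \<longleftrightarrow> \<not> ssat E U t a"
| "ssat E U t (Until I a b) \<longleftrightarrow>
     (\<exists>t'>t. t' - t \<in> ivl_set I \<and> t' \<in> U \<and> ssat E U t' b \<and> (\<forall>t'' \<in> {t<..<t'}. t'' \<in> U \<longrightarrow> ssat E U t'' a))"
| "ssat E U t (Since I a b) \<longleftrightarrow>
     (\<exists>t'\<ge>0. t' < t \<and> t - t' \<in> ivl_set I \<and> t' \<in> U \<and> ssat E U t' b \<and> (\<forall>t'' \<in> {t'<..<t}. t'' \<in> U \<longrightarrow> ssat E U t'' a))"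

text \<open>Over an empty set of propositions no \<^const>\<open>Atom\<close> occurs, so negation is Boolean complementation.\<close>

lemma sat_nnf_iff_ssat:
  assumes "mtl_over {} \<psi>" "\<forall>x \<in> mtl_vars \<psi>. \<exists>\<rho>. \<Pi> x = Some \<rho> \<and> times \<rho> = E x" "U = {t. event \<Pi> t}"
  shows "(sat_nnf \<Pi> t (to_nnf \<psi>) \<longleftrightarrow> ssat E U t \<psi>) \<and> (sat_nnf \<Pi> t (to_nnf (Neg \<psi>)) \<longleftrightarrow> \<not> ssat E U t \<psi>)"
  using assms by (induction \<psi> arbitrary: t) fastforce+

definition universal_ta :: "'p set \<Rightarrow> ('p set, nat, nat) ta" where
  "universal_ta AP = \<lparr>alphabet = Pow AP, locs = {0}, init = 0, clocks = {},
    trans = (\<lambda>a. (0, a, GTrue, {}, 0)) ` Pow AP, accepting = {0}\<rparr>"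

lemma universal_ta: "finite AP \<Longrightarrow> timed_automaton (universal_ta AP)"
  by (auto simp: timed_automaton_def universal_ta_def)

lemma language_universal_ta: "language (universal_ta AP) = timed_words (Pow AP)"
proof -
  have "\<exists>r. run_on (universal_ta AP) \<rho> r \<and> fst (last r) \<in> accepting (universal_ta AP)"
    if \<rho>: "\<rho> \<in> timed_words (Pow AP)" for \<rho>
  proof -
    define r where
      "r = map (\<lambda>i. (0::nat, \<lambda>_::nat. if i = 0 then 0 else snd (\<rho> ! (i - 1)))) [0..<Suc (length \<rho>)]"
    have len: "length r = length \<rho> + 1" by (simp add: r_def)
    have nth: "r ! i = (0, \<lambda>_. if i = 0 then 0 else snd (\<rho> ! (i - 1)))" if "i \<le> length \<rho>" for i
      using that by (simp add: r_def nth_append)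
    have "fst (\<rho> ! i) \<in> Pow AP" if "i < length \<rho>" for i
      using \<rho> imageI[OF nth_mem[OF that], of fst] unfolding timed_words_def by blast
    then have "run_on (universal_ta AP) \<rho> r"
      unfolding run_on_def using len
      by (intro conjI allI impI exI[of _ GTrue] exI[of _ "{}"])
        (simp_all add: nth universal_ta_def delay_def reset_def elapse_def)
    moreover have "fst (last r) = 0"
      using nth[of "length \<rho>"] len by (subst last_conv_nth) auto
    ultimately show ?thesis by (auto simp: universal_ta_def)
  qed
  then show ?thesis by (auto simp: language_def universal_ta_def)
qed

section \<open>Quantifier blocks over an initial segment of trace variables\<close>

primrec exists_upto :: "nat \<Rightarrow> 'p hypermtl \<Rightarrow> 'p hypermtl" where
  "exists_upto 0 \<phi> = \<phi>"
| "exists_upto (Suc m) \<phi> = Exists (Suc m) (exists_upto m \<phi>)"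

primrec forall_upto :: "nat \<Rightarrow> 'p hypermtl \<Rightarrow> 'p hypermtl" where
  "forall_upto 0 \<phi> = \<phi>"
| "forall_upto (Suc m) \<phi> = Forall (Suc m) (forall_upto m \<phi>)"

lemma closed_prefix:
  assumes "mtl_over AP \<psi>" "mtl_vars \<psi> \<subseteq> {..m}"
  shows "closed_hypermtl AP (exists_upto m (Forall 0 (Body \<psi>)))"
    "closed_hypermtl AP (forall_upto m (Exists 0 (Body (Neg \<psi>))))"
proof -
  let ?e = "\<lambda>k. exists_upto k (Forall 0 (Body \<psi>))"
  let ?f = "\<lambda>k. forall_upto k (Exists 0 (Body (Neg \<psi>)))"
  have m: "matrix (?e k) = \<psi>" "matrix (?f k) = Neg \<psi>" for k
    by (induction k) auto
  have b: "set (bound_vars (?e k)) = {..k}" "set (bound_vars (?f k)) = {..k}" for k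
    by (induction k) auto
  have d: "distinct (bound_vars (?e k))" "distinct (bound_vars (?f k))" for k
    by (induction k) (auto simp: b)
  have v: "free_vars (?e k) = mtl_vars \<psi> - {..k} \<and> free_vars (?f k) = mtl_vars \<psi> - {..k}" for k
  proof (induction k)
    case (Suc k)
    then show ?case
      by (simp only: exists_upto.simps forall_upto.simps free_vars.simps atMost_Suc
          Diff_insert[of "mtl_vars \<psi>" "Suc k" "{..k}"] simp_thms)
  qed simp
  show "closed_hypermtl AP (?e m)" "closed_hypermtl AP (?f m)"
    using assms d v by (simp_all add: closed_hypermtl_def m)
qed

lemma exists_forall_prefix: "exists_forall (exists_upto m (Forall 0 (Body \<psi>)))"
  by (induction m) auto

lemma forall_exists_prefix: "forall_exists (forall_upto m (Exists 0 (Body \<psi>)))"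
  by (induction m) auto

definition assign :: "nat \<Rightarrow> 'p assignment \<Rightarrow> (tvar \<Rightarrow> 'p set timed_word) \<Rightarrow> 'p assignment" where
  "assign m \<Pi> \<sigma> = (\<lambda>x. if x \<in> {1..m} then Some (\<sigma> x) else \<Pi> x)"

lemma assign_upd: "assign m (\<Pi>(Suc m \<mapsto> \<rho>)) \<sigma> = assign (Suc m) \<Pi> (\<sigma>(Suc m := \<rho>))"
  by (auto simp: assign_def fun_eq_iff)

lemma sat_exists_upto:
  "sat_hyper T \<Pi> t (exists_upto m \<phi>) \<longleftrightarrow>
    (\<exists>\<sigma>. \<sigma> ` {1..m} \<subseteq> T \<and> sat_hyper T (assign m \<Pi> \<sigma>) t \<phi>)"
proof (induction m arbitrary: \<Pi>)
  case 0
  then show ?case by (simp add: assign_def)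
next
  case (Suc m)
  show ?case
  proof
    assume "sat_hyper T \<Pi> t (exists_upto (Suc m) \<phi>)"
    then obtain \<rho> \<sigma> where "\<rho> \<in> T" "\<sigma> ` {1..m} \<subseteq> T" "sat_hyper T (assign (Suc m) \<Pi> (\<sigma>(Suc m := \<rho>))) t \<phi>"
      unfolding exists_upto.simps sat_hyper.simps Suc.IH assign_upd by blast
    then show "\<exists>\<sigma>. \<sigma> ` {1..Suc m} \<subseteq> T \<and> sat_hyper T (assign (Suc m) \<Pi> \<sigma>) t \<phi>"
      by (intro exI[of _ "\<sigma>(Suc m := \<rho>)"]) auto
  next
    assume "\<exists>\<sigma>. \<sigma> ` {1..Suc m} \<subseteq> T \<and> sat_hyper T (assign (Suc m) \<Pi> \<sigma>) t \<phi>"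
    then obtain \<sigma> where \<sigma>: "\<sigma> ` {1..Suc m} \<subseteq> T" "sat_hyper T (assign (Suc m) \<Pi> \<sigma>) t \<phi>" by blast
    have "\<sigma> (Suc m) \<in> T" "\<sigma> ` {1..m} \<subseteq> T" using \<sigma>(1) by auto
    moreover have "sat_hyper T (assign m (\<Pi>(Suc m \<mapsto> \<sigma> (Suc m))) \<sigma>) t \<phi>"
      unfolding assign_upd using \<sigma>(2) by simp
    ultimately show "sat_hyper T \<Pi> t (exists_upto (Suc m) \<phi>)"
      unfolding exists_upto.simps sat_hyper.simps Suc.IH by blast
  qed
qed

text \<open>The quantifier blocks are dual, but complementary bodies have to be assumed, because
  negation in this semantics is not complementation in general.\<close>

lemma sat_forall_upto:
  assumes "\<And>\<sigma>. \<sigma> ` {1..m} \<subseteq> T \<Longrightarrow> sat_hyper T (assign m \<Pi> \<sigma>) t \<phi>' \<longleftrightarrow> \<not> sat_hyper T (assign m \<Pi> \<sigma>) t \<phi>"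
  shows "sat_hyper T \<Pi> t (forall_upto m \<phi>') \<longleftrightarrow> \<not> sat_hyper T \<Pi> t (exists_upto m \<phi>)"
  using assms
proof (induction m arbitrary: \<Pi>)
  case 0
  then show ?case using 0[of "\<lambda>_. undefined"] by (simp add: assign_def)
next
  case (Suc m)
  have "sat_hyper T (\<Pi>(Suc m \<mapsto> \<rho>)) t (forall_upto m \<phi>') \<longleftrightarrow>
      \<not> sat_hyper T (\<Pi>(Suc m \<mapsto> \<rho>)) t (exists_upto m \<phi>)" if "\<rho> \<in> T" for \<rho>
  proof (rule Suc.IH)
    fix \<sigma> :: "nat \<Rightarrow> ('a set \<times> real) list"
    assume "\<sigma> ` {1..m} \<subseteq> T"
    then have "(\<sigma>(Suc m := \<rho>)) ` {1..Suc m} \<subseteq> T" using that by auto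
    from Suc.prems[OF this] show "sat_hyper T (assign m (\<Pi>(Suc m \<mapsto> \<rho>)) \<sigma>) t \<phi>' \<longleftrightarrow>
        \<not> sat_hyper T (assign m (\<Pi>(Suc m \<mapsto> \<rho>)) \<sigma>) t \<phi>"
      by (simp only: assign_upd)
  qed
  then show ?case by auto
qed

definition set_truth :: "nat \<Rightarrow> 'p mtl \<Rightarrow> bool" where
  "set_truth m \<psi> \<longleftrightarrow> (\<exists>E. E ` {1..m} \<subseteq> time_sets \<and>
    (\<forall>Y \<in> time_sets. ssat (E(0 := Y)) (Y \<union> (\<Union>x\<in>{1..m}. E x)) 0 \<psi>))"

text \<open>Without atoms letters cannot be observed, and every finite set of nonnegative times is
  the set of times of some word; so trace quantifiers become quantifiers over
  \<open>time_sets\<close>.\<close>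

lemma models_iff_set_truth:
  fixes \<psi> :: "'p mtl"
  assumes "mtl_over {} \<psi>" "mtl_vars \<psi> \<subseteq> {..m}"
  shows "models (timed_words (Pow AP)) (exists_upto m (Forall 0 (Body \<psi>))) \<longleftrightarrow> set_truth m \<psi>"
    "models (timed_words (Pow AP)) (forall_upto m (Exists 0 (Body (Neg \<psi>)))) \<longleftrightarrow> \<not> set_truth m \<psi>"
proof -
  let ?T = "timed_words (Pow AP)"
  let ?U = "\<lambda>\<sigma> Y. Y \<union> (\<Union>x\<in>{1..m}. times (\<sigma> x))"
  have body: "(sat_nnf ((assign m Map.empty \<sigma>)(0 \<mapsto> \<rho>)) 0 (to_nnf \<psi>) \<longleftrightarrow>
        ssat ((times \<circ> \<sigma>)(0 := times \<rho>)) (?U \<sigma> (times \<rho>)) 0 \<psi>) \<and>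
      (sat_nnf ((assign m Map.empty \<sigma>)(0 \<mapsto> \<rho>)) 0 (to_nnf (Neg \<psi>)) \<longleftrightarrow>
        \<not> ssat ((times \<circ> \<sigma>)(0 := times \<rho>)) (?U \<sigma> (times \<rho>)) 0 \<psi>)"
    for \<sigma> and \<rho> :: "'p set timed_word"
  proof (rule sat_nnf_iff_ssat)
    have "ran ((assign m Map.empty \<sigma>)(0 \<mapsto> \<rho>)) = insert \<rho> (\<sigma> ` {1..m})"
    proof (intro equalityI subsetI)
      fix w
      assume "w \<in> ran ((assign m Map.empty \<sigma>)(0 \<mapsto> \<rho>))"
      then show "w \<in> insert \<rho> (\<sigma> ` {1..m})"
        by (auto simp: ran_def assign_def split: if_splits)
    next
      fix w
      assume "w \<in> insert \<rho> (\<sigma> ` {1..m})"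
      then obtain x where "w = \<rho> \<and> x = 0 \<or> x \<in> {1..m} \<and> w = \<sigma> x" by blast
      then have "((assign m Map.empty \<sigma>)(0 \<mapsto> \<rho>)) x = Some w"
        by (auto simp: assign_def)
      then show "w \<in> ran ((assign m Map.empty \<sigma>)(0 \<mapsto> \<rho>))" by (rule ranI)
    qed
    then show "?U \<sigma> (times \<rho>) = {t. event ((assign m Map.empty \<sigma>)(0 \<mapsto> \<rho>)) t}"
      unfolding event_def by auto
    show "\<forall>x \<in> mtl_vars \<psi>. \<exists>\<rho>'. ((assign m Map.empty \<sigma>)(0 \<mapsto> \<rho>)) x = Some \<rho>' \<and>
        times \<rho>' = ((times \<circ> \<sigma>)(0 := times \<rho>)) x"
    proof
      fix x
      assume "x \<in> mtl_vars \<psi>"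
      then have "x = 0 \<or> x \<in> {1..m}" using assms(2) by force
      then show "\<exists>\<rho>'. ((assign m Map.empty \<sigma>)(0 \<mapsto> \<rho>)) x = Some \<rho>' \<and>
          times \<rho>' = ((times \<circ> \<sigma>)(0 := times \<rho>)) x"
        by (auto simp: assign_def)
    qed
  qed fact
  have sem: "models ?T (exists_upto m (Forall 0 (Body \<psi>))) \<longleftrightarrow> (\<exists>\<sigma>. \<sigma> ` {1..m} \<subseteq> ?T \<and>
      (\<forall>\<rho> \<in> ?T. ssat ((times \<circ> \<sigma>)(0 := times \<rho>)) (?U \<sigma> (times \<rho>)) 0 \<psi>))"
    by (simp only: models_def sat_exists_upto sat_hyper.simps body)
  show e: "models ?T (exists_upto m (Forall 0 (Body \<psi>))) \<longleftrightarrow> set_truth m \<psi>"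
  proof
    assume "models ?T (exists_upto m (Forall 0 (Body \<psi>)))"
    then obtain \<sigma> where \<sigma>: "\<sigma> ` {1..m} \<subseteq> ?T"
      "\<forall>\<rho> \<in> ?T. ssat ((times \<circ> \<sigma>)(0 := times \<rho>)) (?U \<sigma> (times \<rho>)) 0 \<psi>"
      unfolding sem by blast
    have "(times \<circ> \<sigma>) ` {1..m} \<subseteq> time_sets"
      using \<sigma>(1) by (auto simp flip: times_timed_words[of AP])
    moreover have "\<forall>Y \<in> times ` ?T. ssat ((times \<circ> \<sigma>)(0 := Y)) (?U \<sigma> Y) 0 \<psi>"
      using \<sigma>(2) by blast
    ultimately show "set_truth m \<psi>"
      unfolding set_truth_def times_timed_words by (intro exI[of _ "times \<circ> \<sigma>"]) simp
  next
    assume "set_truth m \<psi>"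
    then obtain E where E: "E ` {1..m} \<subseteq> time_sets"
      "\<forall>Y \<in> time_sets. ssat (E(0 := Y)) (Y \<union> (\<Union>x\<in>{1..m}. E x)) 0 \<psi>"
      unfolding set_truth_def by blast
    have "\<forall>x. \<exists>\<rho>. x \<in> {1..m} \<longrightarrow> \<rho> \<in> ?T \<and> times \<rho> = E x"
    proof (intro allI)
      fix x
      show "\<exists>\<rho>. x \<in> {1..m} \<longrightarrow> \<rho> \<in> ?T \<and> times \<rho> = E x"
      proof (cases "x \<in> {1..m}")
        case True
        then have "E x \<in> times ` ?T" using E(1) times_timed_words by blast
        then show ?thesis by blast
      qed blast
    qed
    then obtain \<sigma> where \<sigma>: "\<And>x. x \<in> {1..m} \<Longrightarrow> \<sigma> x \<in> ?T \<and> times (\<sigma> x) = E x" by metis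
    have "ssat ((times \<circ> \<sigma>)(0 := times \<rho>)) (?U \<sigma> (times \<rho>)) 0 \<psi>" if "\<rho> \<in> ?T" for \<rho>
    proof -
      have "times \<rho> \<in> time_sets" using that times_timed_words by blast
      then have "ssat (E(0 := times \<rho>)) (times \<rho> \<union> (\<Union>x\<in>{1..m}. E x)) 0 \<psi>" using E(2) by blast
      moreover have "(\<Union>x\<in>{1..m}. times (\<sigma> x)) = (\<Union>x\<in>{1..m}. E x)" using \<sigma> by simp
      moreover have "ssat ((times \<circ> \<sigma>)(0 := times \<rho>)) U t \<psi> = ssat (E(0 := times \<rho>)) U t \<psi>" for U t
        using assms(2)
      proof (induction \<psi> arbitrary: t)
        case (Ev x)
        then show ?case using \<sigma>[of x] by (cases "x = 0") auto
      qed (simp_all del: fun_upd_apply)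
      ultimately show ?thesis by simp
    qed
    moreover have "\<sigma> ` {1..m} \<subseteq> ?T" using \<sigma> by blast
    ultimately show "models ?T (exists_upto m (Forall 0 (Body \<psi>)))"
      unfolding sem by (intro exI[of _ \<sigma>]) blast
  qed
  have "models ?T (forall_upto m (Exists 0 (Body (Neg \<psi>)))) \<longleftrightarrow>
      \<not> models ?T (exists_upto m (Forall 0 (Body \<psi>)))"
    unfolding models_def by (rule sat_forall_upto) (simp only: sat_hyper.simps body, blast)
  then show "models ?T (forall_upto m (Exists 0 (Body (Neg \<psi>)))) \<longleftrightarrow> \<not> set_truth m \<psi>"
    using e by simp
qed

section \<open>Runs of a register machine as sets of times\<close>

definition up :: "real set \<Rightarrow> real set \<Rightarrow> real \<Rightarrow> bool" where
  "up Y A t \<longleftrightarrow> (t + 1 \<in> Y \<and> (\<forall>y \<in> Y. y \<le> t + 1) \<longrightarrow> t + 1 \<in> A)"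

definition down :: "real set \<Rightarrow> real set \<Rightarrow> real \<Rightarrow> bool" where
  "down Y A t \<longleftrightarrow> (t - 1 \<in> Y \<and> (\<forall>y \<in> Y. t - 1 \<le> y) \<longrightarrow> t - 1 \<in> A)"

text \<open>On the grid this singles out the points outside the lowest row; at the mark of a
  register it is the test for a nonzero value.\<close>

definition high :: "(nat \<Rightarrow> real set) \<Rightarrow> real \<Rightarrow> bool" where
  "high S t \<longleftrightarrow> (\<exists>z \<in> S 0. 0 \<le> z \<and> z + 1 \<le> t)"

text \<open>Excluding \<open>S 0\<close> prevents the successor from slipping into the beginning of
  the next row.\<close>

definition next_point :: "nat \<Rightarrow> (nat \<Rightarrow> real set) \<Rightarrow> real \<Rightarrow> real \<Rightarrow> bool" where
  "next_point B S t t' \<longleftrightarrow> t < t' \<and> t' \<in> (\<Union>p<B. S p) \<and> t' \<notin> S 0 \<and>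
    (\<forall>u. t < u \<and> u < t' \<longrightarrow> u \<notin> (\<Union>p<B. S p))"

text \<open>Every register mark moves to the next column, staying in its row unless the instruction
  changes that register. The new state is checked only at the register named by the instruction,
  which suffices because states are copied along columns.\<close>

primrec action :: "nat \<Rightarrow> (nat \<Rightarrow> real set) \<Rightarrow> (nat \<Rightarrow> real set) \<Rightarrow> real set \<Rightarrow> nat \<Rightarrow> instr \<Rightarrow> real \<Rightarrow> bool" where
  "action B S R Y k (Inc j q) t \<longleftrightarrow>
    (\<exists>t'. next_point B S t t' \<and> (if j = k then t' \<in> S q \<and> up Y (R k) t' else t' \<in> R k))"
| "action B S R Y k (Dec j q0 q1) t \<longleftrightarrow>
    (if j = k then
      (if high S t then \<exists>t'. next_point B S t t' \<and> t' \<in> S q1 \<and> down Y (R k) t'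
       else \<exists>t'. next_point B S t t' \<and> t' \<in> S q0 \<and> t' \<in> R k)
     else \<exists>t'. next_point B S t t' \<and> t' \<in> R k)"

text \<open>The configuration after \<open>i\<close> steps is the column of all points \<open>f\<^sub>i + r\<close> with \<open>r\<close> a natural number,
  where \<open>f\<^sub>0 < f\<^sub>1 < \<dots> < f\<^sub>0 + 1\<close>. The set \<open>S p\<close> contains every point (below the bound given by \<open>b\<close>) of every column
  in state \<open>p\<close>, and \<open>R k\<close> marks the point \<open>f\<^sub>i + v\<close> when register \<open>k\<close> holds \<open>v\<close>. The start state \<open>0\<close> is never
  re-entered, so the points of \<open>S 0\<close> separate the rows.\<close>

definition encodes ::
    "instr list \<Rightarrow> nat \<Rightarrow> nat \<Rightarrow> nat \<Rightarrow> (nat \<Rightarrow> real set) \<Rightarrow> (nat \<Rightarrow> real set) \<Rightarrow> real set \<Rightarrow> real set \<Rightarrow> bool"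
  where "encodes P B m n S R b Y \<longleftrightarrow>
    (\<forall>p<B. \<forall>t>0. t \<in> S p \<longrightarrow> (\<exists>z \<in> b. t < z)) \<and>
    (\<forall>p<B. \<forall>t>0. t \<in> S p \<and> (\<exists>z \<in> b. t + 1 < z) \<longrightarrow> up Y (S p) t) \<and>
    (\<forall>p<B. \<forall>t>0. t \<in> S p \<and> high S t \<longrightarrow> down Y (S p) t) \<and>
    (\<forall>t>0. t \<in> S 0 \<longrightarrow> \<not> (\<exists>z \<in> S 0. t < z \<and> z < t + 1)) \<and>
    (\<forall>k<B. \<forall>t>0. t \<in> R k \<longrightarrow> (\<exists>z \<in> b. t < z)) \<and>
    (\<forall>p<length P. \<forall>k<B. \<forall>t>0. t \<in> S p \<and> t \<in> R k \<longrightarrow> action B S R Y k (P ! p) t) \<and>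
    (\<forall>t>0. t \<notin> S (Suc (length P))) \<and> 0 \<notin> S 0 \<and>
    (\<exists>t \<in> S 0. 0 < t \<and> t < 1 \<and> (\<forall>k<B. k \<noteq> 1 \<and> k \<noteq> 2 \<longrightarrow> t \<in> R k)) \<and>
    (\<exists>t \<in> S 0. real m < t \<and> t \<le> real m + 1 \<and> t \<in> R 1) \<and>
    (\<exists>t \<in> S 0. real n < t \<and> t \<le> real n + 1 \<and> t \<in> R 2)"

lemma encodesD:
  assumes "encodes P B m n S R b Y"
  shows "\<forall>p<B. \<forall>t>0. t \<in> S p \<longrightarrow> (\<exists>z \<in> b. t < z)"
    "\<forall>p<B. \<forall>t>0. t \<in> S p \<and> (\<exists>z \<in> b. t + 1 < z) \<longrightarrow> up Y (S p) t"
    "\<forall>p<B. \<forall>t>0. t \<in> S p \<and> high S t \<longrightarrow> down Y (S p) t"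
    "\<forall>t>0. t \<in> S 0 \<longrightarrow> \<not> (\<exists>z \<in> S 0. t < z \<and> z < t + 1)"
    "\<forall>k<B. \<forall>t>0. t \<in> R k \<longrightarrow> (\<exists>z \<in> b. t < z)"
    "\<forall>p<length P. \<forall>k<B. \<forall>t>0. t \<in> S p \<and> t \<in> R k \<longrightarrow> action B S R Y k (P ! p) t"
    "\<forall>t>0. t \<notin> S (Suc (length P))"
    "0 \<notin> S 0"
    "\<exists>t \<in> S 0. 0 < t \<and> t < 1 \<and> (\<forall>k<B. k \<noteq> 1 \<and> k \<noteq> 2 \<longrightarrow> t \<in> R k)"
    "\<exists>t \<in> S 0. real m < t \<and> t \<le> real m + 1 \<and> t \<in> R 1"
    "\<exists>t \<in> S 0. real n < t \<and> t \<le> real n + 1 \<and> t \<in> R 2"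
  using assms unfolding encodes_def by - (elim conjE, assumption)+

text \<open>\<open>B\<close> bounds states and registers alike: the inputs sit in registers
  \<open>1\<close> and \<open>2\<close>, and the rejecting address needs a trace of its own so that
  it can be forbidden.\<close>

definition bounded_by :: "nat \<Rightarrow> instr list \<Rightarrow> bool" where
  "bounded_by B P \<longleftrightarrow> 2 < B \<and> Suc (length P) < B \<and>
    (\<forall>i \<in> set P. regs i \<subseteq> {..<B} \<and> targets i \<subseteq> {1..<B})"

section \<open>Soundness: every encoding follows the run of the machine\<close>

locale encoded_machine =
  fixes P B m n S R b
  assumes bounded: "bounded_by B P"
    and enc: "Y \<in> time_sets \<Longrightarrow> encodes P B m n S R b Y"
begin

lemma singleton_time: "0 \<le> t \<Longrightarrow> {t} \<in> time_sets"
  by (simp add: time_sets_def)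

lemma enc_empty: "encodes P B m n S R b {}"
  by (rule enc) (simp add: time_sets_def)

lemma B_bounds: "0 < B" "1 < B" "2 < B" "Suc (length P) < B"
  using bounded by (auto simp: bounded_by_def)

definition below :: "real \<Rightarrow> bool" where
  "below t \<longleftrightarrow> (\<exists>z \<in> b. t < z)"

lemma below_mono: "below t \<Longrightarrow> s \<le> t \<Longrightarrow> below s"
  unfolding below_def by (meson le_less_trans)

lemma below_S: "p < B \<Longrightarrow> 0 < t \<Longrightarrow> t \<in> S p \<Longrightarrow> below t"
  using encodesD(1)[OF enc_empty] by (simp add: below_def)

lemma below_R: "k < B \<Longrightarrow> 0 < t \<Longrightarrow> t \<in> R k \<Longrightarrow> below t"
  using encodesD(5)[OF enc_empty] by (simp add: below_def)

lemma up_S: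
  assumes "p < B" "0 < t" "t \<in> S p" "below (t + 1)"
  shows "t + 1 \<in> S p"
proof -
  \<comment> \<open>Ending \<open>Y\<close> at \<open>t + 1\<close> makes the premise of
    \<open>up\<close> true, so its conclusion is available at the exact distance
    \<open>1\<close>.\<close>
  have "encodes P B m n S R b {t + 1}" using assms by (intro enc singleton_time) simp
  then have "up {t + 1} (S p) t" using assms encodesD(2) unfolding below_def by blast
  then show ?thesis by (simp add: up_def)
qed

lemma down_S:
  assumes "p < B" "0 < t" "t \<in> S p" "z \<in> S 0" "0 \<le> z" "z + 1 \<le> t"
  shows "t - 1 \<in> S p"
proof -
  have "encodes P B m n S R b {t - 1}" using assms by (intro enc singleton_time) simp
  moreover have "high S t" using assms(4-6) unfolding high_def by blast
  ultimately have "down {t - 1} (S p) t" using assms(1-3) encodesD(3) by blast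
  then show ?thesis by (simp add: down_def)
qed

lemma start_unique: "s \<in> S 0 \<Longrightarrow> t \<in> S 0 \<Longrightarrow> 0 \<le> s \<Longrightarrow> s \<le> t \<Longrightarrow> t < s + 1 \<Longrightarrow> s = t"
proof -
  assume st: "s \<in> S 0" "t \<in> S 0" "0 \<le> s" "s \<le> t" "t < s + 1"
  \<comment> \<open>\<open>0 \<notin> S 0\<close> covers \<open>s = 0\<close>, on which the
    separation clause, stated for positive times, is silent.\<close>
  with encodesD(4,8)[OF enc_empty] show "s = t" by (metis less_eq_real_def)
qed

definition start :: real where
  "start = (SOME t. t \<in> S 0 \<and> 0 < t \<and> t < 1 \<and> (\<forall>k<B. k \<noteq> 1 \<and> k \<noteq> 2 \<longrightarrow> t \<in> R k))"

lemma start: "start \<in> S 0" "0 < start" "start < 1" "k < B \<Longrightarrow> k \<noteq> 1 \<Longrightarrow> k \<noteq> 2 \<Longrightarrow> start \<in> R k"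
proof -
  have "\<exists>t. t \<in> S 0 \<and> 0 < t \<and> t < 1 \<and> (\<forall>k<B. k \<noteq> 1 \<and> k \<noteq> 2 \<longrightarrow> t \<in> R k)"
    using encodesD(9)[OF enc_empty] by blast
  from someI_ex[OF this, folded start_def]
  show "start \<in> S 0" "0 < start" "start < 1" "k < B \<Longrightarrow> k \<noteq> 1 \<Longrightarrow> k \<noteq> 2 \<Longrightarrow> start \<in> R k" by blast+
qed

lemma column_up:
  assumes "p < B" "start \<le> f" "real r + f \<in> S p" "below (real (r + d) + f)"
  shows "real (r + d) + f \<in> S p"
  using assms(4)
proof (induction d)
  case 0
  then show ?case using assms(3) by simp
next
  case (Suc d)
  have "real (r + d) + f \<in> S p"
    using Suc.prems by (intro Suc.IH) (auto elim: below_mono)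
  then have "real (r + d) + f + 1 \<in> S p"
    using Suc.prems assms(1,2) start(2) by (intro up_S) (auto simp: algebra_simps)
  then show ?case by (simp add: algebra_simps)
qed

lemma column_down:
  assumes "p < B" "start \<le> f" "real (r + d) + f \<in> S p"
  shows "real r + f \<in> S p"
  using assms(3)
proof (induction d)
  case (Suc d)
  have "real (r + Suc d) + f - 1 \<in> S p"
    using Suc.prems assms(1,2) start(1,2) by (intro down_S[where z = start]) auto
  then show ?case by (intro Suc.IH) (simp add: algebra_simps)
qed simp

text \<open>Up to the bound all rows look alike: shifts by \<open>1\<close> carry a state upwards as
  far as the bound and downwards as far as the lowest row.\<close>

lemma column:
  assumes "p < B" "start \<le> f" "real r + f \<in> S p" "below (real s + f)"
  shows "real s + f \<in> S p"
proof (cases "r \<le> s")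
  case True
  then show ?thesis using column_up[of p f r "s - r"] assms by simp
next
  case False
  then show ?thesis using column_down[of p f s "r - s"] assms by simp
qed

text \<open>The beginning of the next row is itself a grid point, so a successor beyond it would not
  be the nearest one, and \<open>next_point\<close> rules out that beginning itself.\<close>

lemma next_in_row:
  assumes f: "start \<le> f" "f < start + 1" and nx: "next_point B S (real r + f) t'"
  shows "t' - real r < start + 1"
proof (rule ccontr)
  assume "\<not> ?thesis"
  then have le: "real (Suc r) + start \<le> t'" by simp
  obtain p where "p < B" "t' \<in> S p" using nx unfolding next_point_def by auto
  then have "below t'" using le start(2) by (intro below_S) auto
  then have "real (Suc r) + start \<in> S 0"
    using column[of 0 start 0 "Suc r"] start(1) B_bounds(1) below_mono[OF _ le] by simp
  moreover have "real r + f < real (Suc r) + start" using f by simp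
  ultimately show False
    using nx le B_bounds(1) unfolding next_point_def by (metis UN_I lessThan_iff order_le_less)
qed

text \<open>A nearer successor in row \<open>r\<close> could be copied to row \<open>s\<close>,
  strictly before the alleged successor there. The copy exists because it lies below a grid point,
  hence below the bound.\<close>

lemma next_column_aux:
  assumes f: "start \<le> f" "f < start + 1"
    and r: "next_point B S (real r + f) t'" and s: "next_point B S (real s + f) t''"
  shows "\<not> t' - real r < t'' - real s"
proof
  assume lt: "t' - real r < t'' - real s"
  obtain p where p: "p < B" "t' \<in> S p" using r unfolding next_point_def by auto
  obtain p'' where p'': "p'' < B" "t'' \<in> S p''" using s unfolding next_point_def by auto
  have tt: "real r + f < t'" "real s + f < t''" using r s unfolding next_point_def by auto
  have "below t''" using p'' tt f start(2) by (intro below_S) auto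
  then have "below (real s + (t' - real r))" by (rule below_mono) (use lt in simp)
  moreover have "real r + (t' - real r) \<in> S p" using p by simp
  moreover have "start \<le> t' - real r" using tt f by simp
  ultimately have "real s + (t' - real r) \<in> S p"
    using column[OF p(1)] by blast
  moreover have "real s + f < real s + (t' - real r)" "real s + (t' - real r) < t''"
    using tt lt by auto
  ultimately show False using s p(1) unfolding next_point_def by blast
qed

lemma next_column:
  assumes "start \<le> f" "f < start + 1"
    "next_point B S (real r + f) t'" "next_point B S (real s + f) t''"
  shows "t'' = real s + (t' - real r)"
  using next_column_aux[OF assms] next_column_aux[OF assms(1,2,4,3)] by simp

text \<open>One correct mark per register is asserted, not its uniqueness. Stray marks do no harm,
  since the conditions on the next column apply to every mark separately.\<close>

definition column_of :: "real \<Rightarrow> nat \<times> (nat \<Rightarrow> nat) \<Rightarrow> bool" where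
  "column_of f = (\<lambda>(p, v). p < B \<and> start \<le> f \<and> f < start + 1 \<and>
    (\<forall>r. below (real r + f) \<longrightarrow> real r + f \<in> S p) \<and> (\<forall>k<B. real (v k) + f \<in> R k))"

text \<open>This is how the non-singular interval from \<open>l\<close> to \<open>l + 1\<close>
  fixes an exact value: as \<open>0 < start < 1\<close>, it contains the beginning of row
  \<open>l\<close>, and positive points of \<open>S 0\<close> are at least \<open>1\<close>
  apart.\<close>

lemma start_column:
  assumes "t \<in> S 0" "real l < t" "t \<le> real l + 1"
  shows "t = real l + start"
proof (cases "real l + start \<le> t")
  case True
  have "below t" using assms B_bounds by (intro below_S) auto
  then have "real l + start \<in> S 0"
    using column[of 0 start 0 l] start(1) B_bounds(1) below_mono[OF _ True] by simp
  then show ?thesis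
    using start_unique[OF _ assms(1)] True assms(3) start(2) by force
next
  case False
  show ?thesis
  proof (cases l)
    case 0
    then show ?thesis using start_unique[OF assms(1) start(1)] False assms start by simp
  next
    case (Suc l')
    \<comment> \<open>A point before the beginning of row \<open>l\<close> would be less than
      \<open>1\<close> after the beginning of the row below, hence equal to it, although it lies
      above \<open>l\<close>.\<close>
    have lt: "real l' + start < t" using Suc assms(2) start(3) by simp
    have "below t" using assms B_bounds by (intro below_S) auto
    then have "real l' + start \<in> S 0"
      using column[of 0 start 0 l'] start(1) B_bounds(1) below_mono[OF _ less_imp_le[OF lt]] by simp
    then have "real l' + start = t"
      using Suc False lt assms(1) start(2) by (intro start_unique) auto
    then show ?thesis using lt by simp
  qed
qed

lemma column_init: "column_of start (0, input m n)"
proof -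
  have "start + real 0 \<in> S 0" using start(1) by simp
  then have S: "real r + start \<in> S 0" if "below (real r + start)" for r
    using column[of 0 start 0 r] B_bounds that by simp
  have "real m + start \<in> R 1" "real n + start \<in> R 2"
    using encodesD(10,11)[OF enc_empty] start_column by blast+
  then have "real (input m n k) + start \<in> R k" if "k < B" for k
    using start(4)[OF that] by (cases "k = 1 \<or> k = 2") (auto simp: input_def)
  then show ?thesis using S B_bounds by (simp add: column_of_def)
qed

lemma column_step:
  assumes "column_of f (p, v)"
  shows "\<exists>f'. column_of f' (step P (p, v))"
proof (cases "p < length P")
  case False
  then show ?thesis using assms by auto
next
  case True
  have f: "p < B" "start \<le> f" "f < start + 1" "\<And>r. below (real r + f) \<Longrightarrow> real r + f \<in> S p"
    "\<And>k. k < B \<Longrightarrow> real (v k) + f \<in> R k"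
    using assms by (auto simp: column_of_def)
  \<comment> \<open>A mark lies below the bound, so the point it occupies is in state
    \<open>p\<close> and the clause for \<open>p\<close> applies to it.\<close>
  have act: "action B S R Y k (P ! p) (real (v k) + f)" if "k < B" "Y \<in> time_sets" for k Y
  proof -
    have pos: "0 < real (v k) + f" using f(2) start(2) by simp
    have "real (v k) + f \<in> S p" using f(4) below_R[OF that(1) pos f(5)[OF that(1)]] .
    then show ?thesis using encodesD(6)[OF enc[OF that(2)]] f(5)[OF that(1)] that(1) True pos by blast
  qed
  have empty: "{} \<in> time_sets" by (simp add: time_sets_def)
  have P_p: "P ! p \<in> set P" using True by simp
  have wf: "regs (P ! p) \<subseteq> {..<B}" "targets (P ! p) \<subseteq> {1..<B}"
    using bounded P_p unfolding bounded_by_def by auto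
  text \<open>The successor column is read off from the register \<open>j\<close> on which the instruction acts.\<close>
  have successor: "column_of (t' - real (v j)) (q, w)"
    if nx: "next_point B S (real (v j) + f) t'" and q: "t' \<in> S q" "q < B" and j: "j < B"
      and w: "\<And>k. k \<noteq> j \<Longrightarrow> w k = v k" and wj: "real (w j) + (t' - real (v j)) \<in> R j"
      and other: "\<And>k. k < B \<Longrightarrow> k \<noteq> j \<Longrightarrow> \<exists>t'. next_point B S (real (v k) + f) t' \<and> t' \<in> R k"
    for j t' q w
  proof -
    have lt: "real (v j) + f < t'" using nx by (simp add: next_point_def)
    have "t' - real (v j) < start + 1" by (rule next_in_row[OF f(2,3) nx])
    moreover have "real r + (t' - real (v j)) \<in> S q" if "below (real r + (t' - real (v j)))" for r
      using column[of q "t' - real (v j)" "v j" r] q that lt f(2) by simp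
    moreover have "real (w k) + (t' - real (v j)) \<in> R k" if k: "k < B" for k
    proof (cases "k = j")
      case False
      obtain u where u: "next_point B S (real (v k) + f) u" "u \<in> R k" using other[OF k False] by blast
      with next_column[OF f(2,3) nx u(1)] show ?thesis using w[OF False] by simp
    qed (use wj in simp)
    ultimately show ?thesis using lt f(2) q(2) by (simp add: column_of_def)
  qed
  show ?thesis
  proof (cases "P ! p")
    case (Inc j q)
    have j: "j < B" "q < B" using wf Inc by auto
    obtain t' where t': "next_point B S (real (v j) + f) t'" "t' \<in> S q"
      using act[OF j(1) empty] Inc by auto
    \<comment> \<open>The clause for each \<open>Y\<close> yields its own successor point. The empty
      \<open>Y\<close> provides \<open>t'\<close>, from which the singleton is built; the two
      successors agree because they start from the same point.\<close>
    have "0 \<le> t' + 1" using t'(1) f(2) start(2) by (simp add: next_point_def)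
    from act[OF j(1) singleton_time[OF this]] Inc obtain t'' where
      t'': "next_point B S (real (v j) + f) t''" "up {t' + 1} (R j) t''" by auto
    have "t'' = t'" using next_column[OF f(2,3) t'(1) t''(1)] by simp
    then have "t' + 1 \<in> R j" using t''(2) by (simp add: up_def)
    moreover have "\<exists>t'. next_point B S (real (v k) + f) t' \<and> t' \<in> R k" if "k < B" "k \<noteq> j" for k
      using act[OF that(1) empty] Inc that(2) by auto
    ultimately have "column_of (t' - real (v j)) (q, v(j := Suc (v j)))"
      using t' j by (intro successor) (auto simp: add.commute)
    then show ?thesis using True Inc by auto
  next
    case (Dec j q0 q1)
    have j: "j < B" "q0 < B" "q1 < B" using wf Dec by auto
    have other: "\<exists>t'. next_point B S (real (v k) + f) t' \<and> t' \<in> R k" if "k < B" "k \<noteq> j" for k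
      using act[OF that(1) empty] Dec that(2) by auto
    show ?thesis
    proof (cases "v j = 0")
      case v: True
      have "\<not> high S (real (v j) + f)"
      proof
        assume "high S (real (v j) + f)"
        then obtain z where z: "z \<in> S 0" "0 \<le> z" "z + 1 \<le> f" using v by (auto simp: high_def)
        then have "z = start" using start f(3) by (intro start_unique) auto
        then show False using z f(3) by simp
      qed
      then obtain t' where t': "next_point B S (real (v j) + f) t'" "t' \<in> S q0" "t' \<in> R j"
        using act[OF j(1) empty] Dec by auto
      then have "column_of (t' - real (v j)) (q0, v)"
        using j other by (intro successor) auto
      then show ?thesis using True Dec v by auto
    next
      case v: False
      then have "high S (real (v j) + f)"
        using start f(2) by (intro high_def[THEN iffD2] bexI[of _ start]) auto
      then have act': "\<exists>t'. next_point B S (real (v j) + f) t' \<and> t' \<in> S q1 \<and> down Y (R j) t'"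
        if "Y \<in> time_sets" for Y using act[OF j(1) that] Dec by simp
      obtain t' where t': "next_point B S (real (v j) + f) t'" "t' \<in> S q1"
        using act'[OF empty] by blast
      have "1 \<le> real (v j)" using v by simp
      then have "0 \<le> t' - 1" using t'(1) f(2) start(2) unfolding next_point_def by linarith
      from act'[OF singleton_time[OF this]] obtain t'' where
        t'': "next_point B S (real (v j) + f) t''" "down {t' - 1} (R j) t''" by blast
      have "t'' = t'" using next_column[OF f(2,3) t'(1) t''(1)] by simp
      then have "t' - 1 \<in> R j" using t''(2) by (simp add: down_def)
      then have "column_of (t' - real (v j)) (q1, v(j := v j - 1))"
        using t' j other v by (intro successor) (auto simp: of_nat_diff)
      then show ?thesis using True Dec v by auto
    qed
  qed
qed

text \<open>Every configuration of the run occupies a column. Its mark for register \<open>0\<close>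
  shows that the column has a positive point below the bound, and such a point cannot lie in the
  forbidden set.\<close>

lemma not_rejecting: "fst ((step P ^^ i) (0, input m n)) \<noteq> Suc (length P)"
proof -
  have "\<exists>f. column_of f ((step P ^^ i) (0, input m n))"
  proof (induction i)
    case 0
    show ?case using column_init by auto
  next
    case (Suc i)
    obtain p v where pv: "(step P ^^ i) (0, input m n) = (p, v)" by fastforce
    obtain f where "column_of f (p, v)" using Suc unfolding pv by blast
    then show ?case using column_step by (simp only: funpow.simps comp_def pv)
  qed
  then obtain f where f: "column_of f ((step P ^^ i) (0, input m n))" by blast
  obtain p v where pv: "(step P ^^ i) (0, input m n) = (p, v)" by fastforce
  have c: "start \<le> f" "\<And>r. below (real r + f) \<Longrightarrow> real r + f \<in> S p" "real (v 0) + f \<in> R 0" "p < B"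
    using f B_bounds by (auto simp: pv column_of_def)
  have pos: "0 < real (v 0) + f" using c(1) start(2) by simp
  have "real (v 0) + f \<in> S p" using c(2) below_R[OF B_bounds(1) pos c(3)] .
  then show ?thesis using encodesD(7)[OF enc_empty] pos pv by auto
qed

end

section \<open>Completeness: an accepting run can be drawn as a finite grid\<close>

locale accepting_run =
  fixes P :: "instr list" and B m n H :: nat
  assumes bounded: "bounded_by B P"
    and accepting: "fst ((step P ^^ H) (0, input m n)) = length P"
    and running: "i < H \<Longrightarrow> fst ((step P ^^ i) (0, input m n)) < length P"
    and nonempty: "P \<noteq> []"
begin

definition state :: "nat \<Rightarrow> nat" where
  "state i = fst ((step P ^^ i) (0, input m n))"

definition val :: "nat \<Rightarrow> nat \<Rightarrow> nat" where
  "val i = snd ((step P ^^ i) (0, input m n))"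

definition N :: nat where "N = Suc H"

text \<open>A crude common bound: the sum of all register values of the run exceeds or equals each
  of them, so \<open>W\<close> rows hold all marks.\<close>

definition W :: nat where "W = Suc (\<Sum>i\<le>H. \<Sum>k<B. val i k)"

text \<open>Grid points are numbered row by row: \<open>a mod N\<close> is the column, that is, the
  step of the run, and \<open>a div N\<close> is the row. The \<open>+ 1\<close> keeps all times
  positive, as \<open>0\<close> must not be in \<open>S 0\<close>.\<close>

definition \<tau> :: "nat \<Rightarrow> real" where "\<tau> a = (real a + 1) / real N"

definition SS :: "nat \<Rightarrow> real set" where
  "SS p = \<tau> ` {a. a < W * N \<and> state (a mod N) = p}"

definition RR :: "nat \<Rightarrow> real set" where
  "RR k = \<tau> ` {a. a < W * N \<and> a div N = val (a mod N) k}"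

lemma N_pos: "0 < N" by (simp add: N_def)

lemma \<tau>_less [simp]: "\<tau> a < \<tau> c \<longleftrightarrow> a < c"
  using N_pos by (simp add: \<tau>_def divide_less_cancel)

lemma \<tau>_le [simp]: "\<tau> a \<le> \<tau> c \<longleftrightarrow> a \<le> c"
  by (simp flip: not_less)

lemma \<tau>_eq [simp]: "\<tau> a = \<tau> c \<longleftrightarrow> a = c"
  by (metis \<tau>_less linorder_neq_iff)

lemma \<tau>_pos [simp]: "0 < \<tau> a"
  using N_pos by (simp add: \<tau>_def add_pos_nonneg)

lemma \<tau>_plus: "\<tau> a + 1 = \<tau> (a + N)"
  using N_pos by (simp add: \<tau>_def field_simps)

lemma \<tau>_minus: "N \<le> a \<Longrightarrow> \<tau> a - 1 = \<tau> (a - N)"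
  using \<tau>_plus[of "a - N"] by simp

lemma in_SS [simp]: "\<tau> a \<in> SS p \<longleftrightarrow> a < W * N \<and> state (a mod N) = p"
  by (auto simp: SS_def)

lemma in_RR [simp]: "\<tau> a \<in> RR k \<longleftrightarrow> a < W * N \<and> a div N = val (a mod N) k"
  by (auto simp: RR_def)

lemma SS_E: assumes "t \<in> SS p" obtains a where "t = \<tau> a" "a < W * N" "state (a mod N) = p"
  using assms by (auto simp: SS_def)

lemma RR_E: assumes "t \<in> RR k" obtains a where "t = \<tau> a" "a < W * N" "a div N = val (a mod N) k"
  using assms by (auto simp: RR_def)

lemma mod_le: "a mod N \<le> H"
  using mod_less_divisor[OF N_pos, of a] by (simp add: N_def)

lemma B_bounds: "0 < B" "2 < B" "Suc (length P) < B"
  using bounded by (auto simp: bounded_by_def)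

text \<open>With a single column the first point \<open>1 / N\<close> would be \<open>1\<close>,
  outside the range allowed for the start.\<close>

lemma H_pos: "0 < H"
  using accepting nonempty by (cases H) auto

lemma step_Suc: "(state (Suc i), val (Suc i)) = step P (state i, val i)"
  by (simp add: state_def val_def del: step.simps)

lemma state_less: "i \<le> H \<Longrightarrow> state i < B"
  using running[of i] accepting B_bounds by (cases "i = H") (auto simp: state_def)

lemma val_less: "i \<le> H \<Longrightarrow> k < B \<Longrightarrow> val i k < W"
proof -
  assume i: "i \<le> H" "k < B"
  have "val i k \<le> (\<Sum>k<B. val i k)" using i by (intro member_le_sum) auto
  also have "\<dots> \<le> (\<Sum>i\<le>H. \<Sum>k<B. val i k)"
    using i member_le_sum[of i "{..H}" "\<lambda>i. \<Sum>k<B. val i k"] by simp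
  finally show ?thesis by (simp add: W_def)
qed

lemma state_run: "i < H \<Longrightarrow> state i < length P"
  using running by (simp add: state_def)

text \<open>Jump targets are at least \<open>1\<close>, so the start state fills the first column
  only.\<close>

lemma state_0: "i \<le> H \<Longrightarrow> state i = 0 \<longleftrightarrow> i = 0"
proof (cases i)
  case 0
  then show ?thesis by (simp add: state_def)
next
  case (Suc j)
  assume "i \<le> H"
  then have j: "state j < length P" using Suc state_run by simp
  then have P: "P ! state j \<in> set P" by simp
  have "targets (P ! state j) \<subseteq> {1..<B}"
    using bounded P unfolding bounded_by_def by blast
  moreover have "state i \<in> targets (P ! state j)"
    using step_Suc[of j] j Suc by (cases "P ! state j") (auto split: if_splits)
  ultimately show ?thesis using Suc by force
qed

lemma start_state: "state (a mod N) = 0 \<longleftrightarrow> a mod N = 0"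
  using state_0[OF mod_le] .

lemma in_range: "a div N < W \<Longrightarrow> a < W * N"
  using N_pos by (simp add: div_less_iff_less_mult)

lemma grid: "(\<Union>p<B. SS p) = \<tau> ` {..<W * N}"
  using state_less[OF mod_le] by (auto elim!: SS_E)

lemma high_iff: "a < W * N \<Longrightarrow> high SS (\<tau> a) \<longleftrightarrow> N \<le> a"
proof
  assume "high SS (\<tau> a)"
  then obtain c where "\<tau> c + 1 \<le> \<tau> a" unfolding high_def by (auto elim!: SS_E)
  then show "N \<le> a" by (simp add: \<tau>_plus)
next
  assume a: "a < W * N" "N \<le> a"
  have "0 < W * N" using N_pos by (simp add: W_def)
  then have "\<tau> 0 \<in> SS 0" using start_state[of 0] by simp
  then show "high SS (\<tau> a)"
    using a(2) less_imp_le[OF \<tau>_pos] unfolding high_def by (intro bexI[of _ "\<tau> 0"]) (simp_all add: \<tau>_plus)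
qed

lemma Suc_col:
  assumes "a mod N < H"
  shows "Suc a mod N = Suc (a mod N)" "Suc a div N = a div N"
  using assms by (auto simp: mod_Suc div_Suc N_def)

lemma next_grid:
  assumes "a < W * N" "a mod N < H"
  shows "next_point B SS (\<tau> a) (\<tau> (Suc a))"
proof -
  have "Suc a div N < W"
    using assms Suc_col(2)[OF assms(2)] N_pos by (simp add: div_less_iff_less_mult)
  then have "Suc a < W * N" by (rule in_range)
  moreover have "state (Suc a mod N) \<noteq> 0"
    using start_state[of "Suc a"] Suc_col(1)[OF assms(2)] by simp
  ultimately show ?thesis
    unfolding next_point_def grid by auto
qed

lemma action_run:
  assumes a: "a < W * N" and p: "state (a mod N) < length P" and k: "k < B" "a div N = val (a mod N) k"
  shows "action B SS RR Y k (P ! state (a mod N)) (\<tau> a)"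
proof -
  define i where "i = a mod N"
  \<comment> \<open>In the last column the machine has halted at \<open>length P\<close>; so a point
    whose state is an instruction has a right neighbour in its row.\<close>
  have i: "i < H"
    using p accepting mod_le[of a] by (cases "i = H") (auto simp: i_def state_def)
  note col = Suc_col[OF i[unfolded i_def], folded i_def]
  note nx = next_grid[OF a i[unfolded i_def]]
  have st: "(state (Suc i), val (Suc i)) = step P (state i, val i)" by (rule step_Suc)
  have p': "state i < length P" using p by (simp add: i_def)
  have Suc_a: "Suc a < W * N"
    using a col N_pos by (intro in_range) (simp add: div_less_iff_less_mult)
  have copy: "\<tau> (Suc a) \<in> RR k" if "val (Suc i) k = val i k"
    using that Suc_a col k(2) by (simp add: i_def)
  have new: "\<tau> (Suc a) \<in> SS (state (Suc i))" using Suc_a col by simp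
  have bnd: "val (Suc i) k < W" using i k by (intro val_less) auto
  show ?thesis
  proof (cases "P ! state i")
    case (Inc j q)
    have v: "state (Suc i) = q" "val (Suc i) = (val i)(j := Suc (val i j))"
      using st p' Inc by auto
    show ?thesis
    proof (cases "j = k")
      case True
      have "\<tau> (Suc a) + 1 \<in> RR k"
        unfolding \<tau>_plus in_RR
      proof
        have d: "(Suc a + N) div N = Suc (Suc a div N)" "(Suc a + N) mod N = Suc a mod N"
          using div_add_self2[of N "Suc a"] N_pos by (simp_all only: mod_add_self2)
        have eq: "Suc (a div N) = val (Suc i) k"
          using k(2) v(2) True by (simp add: i_def)
        show "(Suc a + N) div N = val ((Suc a + N) mod N) k"
          unfolding d col by (rule eq)
        \<comment> \<open>\<open>W\<close> also exceeds the register after the increment, so the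
          raised mark stays inside the grid.\<close>
        show "Suc a + N < W * N"
          by (rule in_range) (unfold d col eq, rule bnd)
      qed
      then have "up Y (RR k) (\<tau> (Suc a))" by (simp add: up_def)
      then show ?thesis using Inc nx new v True unfolding i_def by auto
    next
      case False
      then show ?thesis using Inc nx copy v unfolding i_def by auto
    qed
  next
    case (Dec j q0 q1)
    show ?thesis
    proof (cases "j = k")
      case jk: True
      show ?thesis
      proof (cases "N \<le> a")
        case True
        then have pos: "val i k \<noteq> 0"
          using N_pos k(2) div_greater_zero_iff[of a N] by (simp add: i_def)
        then have v: "state (Suc i) = q1" "val (Suc i) = (val i)(j := val i j - 1)"
          using st p' Dec jk by auto
        have N: "N \<le> Suc a" using True by simp
        have d: "(Suc a - N) div N = Suc a div N - 1" "(Suc a - N) mod N = Suc a mod N"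
          using N N_pos by (simp_all add: le_div_geq le_mod_geq)
        have "\<tau> (Suc a) - 1 \<in> RR k"
          unfolding \<tau>_minus[OF N] in_RR
        proof
          show "(Suc a - N) div N = val ((Suc a - N) mod N) k"
            unfolding d col using k(2) v(2) jk by (simp add: i_def)
          show "Suc a - N < W * N" using Suc_a by simp
        qed
        then have "down Y (RR k) (\<tau> (Suc a))" by (simp add: down_def)
        then show ?thesis using Dec nx new v jk high_iff[OF a] True unfolding i_def by auto
      next
        case False
        then have "val i k = 0" using k(2) by (simp add: i_def)
        then have v: "state (Suc i) = q0" "val (Suc i) = val i"
          using st p' Dec jk by auto
        then show ?thesis using Dec nx new jk high_iff[OF a] False copy unfolding i_def by auto
      qed
    next
      case False
      have "val (Suc i) k = val i k"
        using st p' Dec False by (auto split: if_splits)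
      then show ?thesis using Dec nx copy False unfolding i_def by auto
    qed
  qed
qed

text \<open>The bounding event is the first point beyond the grid. Any \<open>Y\<close> is fine
  because the points at distance exactly \<open>1\<close> are really there: \<open>up\<close> and
  \<open>down\<close> hold by their conclusions.\<close>

lemma encodes_run: "encodes P B m n SS RR {\<tau> (W * N)} Y"
  unfolding encodes_def
proof (intro conjI allI ballI impI)
  fix p t assume "t \<in> SS p"
  then show "\<exists>z\<in>{\<tau> (W * N)}. t < z" by (auto elim!: SS_E)
next
  fix p t assume *: "t \<in> SS p \<and> (\<exists>z\<in>{\<tau> (W * N)}. t + 1 < z)"
  then obtain a where "t = \<tau> a" "state (a mod N) = p" by (auto elim: SS_E)
  with * have "t + 1 \<in> SS p" by (simp add: \<tau>_plus)
  then show "up Y (SS p) t" by (simp add: up_def)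
next
  fix p t assume *: "t \<in> SS p \<and> high SS t"
  then obtain a where a: "t = \<tau> a" "a < W * N" "state (a mod N) = p" by (auto elim: SS_E)
  with * have "N \<le> a" using high_iff by blast
  with a have "t - 1 \<in> SS p" by (simp add: \<tau>_minus le_mod_geq)
  then show "down Y (SS p) t" by (simp add: down_def)
next
  fix t assume "t \<in> SS 0"
  then obtain a where a: "t = \<tau> a" "a mod N = 0" using start_state by (auto elim: SS_E)
  show "\<not> (\<exists>z\<in>SS 0. t < z \<and> z < t + 1)"
  proof
    assume "\<exists>z\<in>SS 0. t < z \<and> z < t + 1"
    then obtain c where "a < c" "c < a + N" "c mod N = 0"
      using a(1) start_state by (auto elim!: SS_E simp: \<tau>_plus)
    \<comment> \<open>Points in state \<open>0\<close> carry multiples of \<open>N\<close>, and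
      \<open>N\<close> steps on the grid make up one time unit.\<close>
    then have "N dvd c - a" "0 < c - a" "c - a < N"
      using a(2) by (auto simp: mod_eq_0_iff_dvd intro: dvd_diff_nat)
    then show False using nat_dvd_not_less by blast
  qed
next
  fix k t assume "t \<in> RR k"
  then show "\<exists>z\<in>{\<tau> (W * N)}. t < z" by (auto elim!: RR_E)
next
  fix p k t assume *: "p < length P" "k < B" "t \<in> SS p \<and> t \<in> RR k"
  then obtain a where a: "t = \<tau> a" "a < W * N" "state (a mod N) = p" by (auto elim: SS_E)
  with * show "action B SS RR Y k (P ! p) t"
    using action_run[of a k Y] by auto
next
  fix t :: real
  have "state i \<noteq> Suc (length P)" if "i \<le> H" for i
    using that state_run[of i] accepting by (cases "i = H") (auto simp: state_def)
  then show "t \<notin> SS (Suc (length P))" using mod_le by (auto elim!: SS_E)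
next
  show "0 \<notin> SS 0"
  proof
    assume "0 \<in> SS 0"
    then obtain a where "0 = \<tau> a" by (elim SS_E)
    then show False using \<tau>_pos[of a] by simp
  qed
next
  have W: "0 < W * N" using N_pos by (simp add: W_def)
  have v0: "val 0 = input m n" by (simp add: val_def)
  have "\<tau> 0 < 1" using H_pos by (simp add: \<tau>_def N_def)
  moreover have "\<tau> 0 \<in> SS 0" using W start_state[of 0] by simp
  moreover have "\<tau> 0 \<in> RR k" if "k \<noteq> 1 \<and> k \<noteq> 2" for k
    using W v0 that by (simp add: input_def)
  ultimately show "\<exists>t\<in>SS 0. 0 < t \<and> t < 1 \<and> (\<forall>k<B. k \<noteq> 1 \<and> k \<noteq> 2 \<longrightarrow> t \<in> RR k)"
    by (intro bexI[of _ "\<tau> 0"]) auto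
  \<comment> \<open>The number \<open>l * N\<close> belongs to row \<open>l\<close> and column
    \<open>0\<close>, at time \<open>l + 1 / N\<close>.\<close>
  have input_point: "\<exists>t\<in>SS 0. real l < t \<and> t \<le> real l + 1 \<and> t \<in> RR k" if "l = input m n k" "k < B" for l k
  proof (rule bexI[of _ "\<tau> (l * N)"])
    have "l * N < W * N" using val_less[of 0 k] that v0 N_pos by simp
    then show "\<tau> (l * N) \<in> SS 0"
      using start_state[of "l * N"] by simp
    have "\<tau> (l * N) = real l + 1 / real N"
      using N_pos by (simp add: \<tau>_def field_simps)
    moreover have "0 < 1 / real N" "1 / real N \<le> 1" using N_pos by auto
    moreover have "\<tau> (l * N) \<in> RR k"
      unfolding in_RR using \<open>l * N < W * N\<close> v0 that N_pos by simp
    ultimately show "real l < \<tau> (l * N) \<and> \<tau> (l * N) \<le> real l + 1 \<and> \<tau> (l * N) \<in> RR k"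
      by simp
  qed
  show "\<exists>t\<in>SS 0. real m < t \<and> t \<le> real m + 1 \<and> t \<in> RR 1"
    using B_bounds by (intro input_point) (simp_all add: input_def)
  show "\<exists>t\<in>SS 0. real n < t \<and> t \<le> real n + 1 \<and> t \<in> RR 2"
    using B_bounds by (intro input_point) (simp_all add: input_def)
qed

lemma time_sets_run: "SS p \<in> time_sets" "RR k \<in> time_sets" "{\<tau> c} \<in> time_sets"
  using less_imp_le[OF \<tau>_pos] by (auto simp: time_sets_def SS_def RR_def)

end

section \<open>Formulas describing a run\<close>

definition Imp :: "'p mtl \<Rightarrow> 'p mtl \<Rightarrow> 'p mtl" where
  "Imp a c = Neg (Conj a (Neg c))"

definition Fut :: "ivl \<Rightarrow> 'p mtl \<Rightarrow> 'p mtl" where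
  "Fut I a = Until I TT a"

definition Past :: "ivl \<Rightarrow> 'p mtl \<Rightarrow> 'p mtl" where
  "Past I a = Since I TT a"

definition Always :: "'p mtl \<Rightarrow> 'p mtl" where
  "Always a = Neg (Fut (Unbounded False 0) (Neg a))"

text \<open>\<open>TT\<close> fails at times without events, so the empty conjunction is the
  tautology \<open>Imp TT TT\<close> instead.\<close>

definition Conjs :: "'p mtl list \<Rightarrow> 'p mtl" where
  "Conjs as = foldr Conj as (Imp TT TT)"

text \<open>Variable \<open>0\<close> is the universal trace and \<open>1\<close> the bound; states
  take the even and registers the odd numbers above, so \<open>B\<close> of each end at
  \<open>2 * B + 1\<close>.\<close>

definition state_var :: "nat \<Rightarrow> tvar" where "state_var p = 2 * p + 2"
definition reg_var :: "nat \<Rightarrow> tvar" where "reg_var k = 2 * k + 3"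

abbreviation St :: "nat \<Rightarrow> 'p mtl" where "St p \<equiv> Ev (state_var p)"
abbreviation Rg :: "nat \<Rightarrow> 'p mtl" where "Rg k \<equiv> Ev (reg_var k)"
abbreviation Bd :: "'p mtl" where "Bd \<equiv> Ev (Suc 0)"

text \<open>All intervals are nonsingular; a distance of exactly \<open>1\<close> is enforced by the universally
  quantified trace \<open>0\<close>, whose last (first) event has distance at least \<open>1\<close> but not more.\<close>

definition Up :: "'p mtl \<Rightarrow> 'p mtl" where
  "Up a = Imp (Conj (Fut (Unbounded True 1) (Ev 0)) (Neg (Fut (Unbounded False 1) (Ev 0))))
    (Fut (Unbounded True 1) (Conj (Ev 0) a))"

definition Down :: "'p mtl \<Rightarrow> 'p mtl" where
  "Down a = Imp (Conj (Past (Unbounded True 1) (Ev 0)) (Neg (Past (Unbounded False 1) (Ev 0))))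
    (Past (Unbounded True 1) (Conj (Ev 0) a))"

definition High :: "'p mtl" where
  "High = Past (Unbounded True 1) (St 0)"

definition Grid :: "nat \<Rightarrow> 'p mtl" where
  "Grid B = Neg (Conjs (map (\<lambda>p. Neg (St p)) [0..<B]))"

definition Next :: "nat \<Rightarrow> 'p mtl \<Rightarrow> 'p mtl" where
  "Next B a = Until (Unbounded False 0) (Neg (Grid B)) (Conj (Grid B) (Conj (Neg (St 0)) a))"

primrec Action :: "nat \<Rightarrow> nat \<Rightarrow> instr \<Rightarrow> 'p mtl" where
  "Action B k (Inc j q) = Next B (if j = k then Conj (St q) (Up (Rg k)) else Rg k)"
| "Action B k (Dec j q0 q1) =
    (if j = k then Conj (Imp High (Next B (Conj (St q1) (Down (Rg k)))))
       (Imp (Neg High) (Next B (Conj (St q0) (Rg k))))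
     else Next B (Rg k))"

definition Program :: "instr list \<Rightarrow> nat \<Rightarrow> 'p mtl" where
  "Program P B = Conjs [
     Conjs (map (\<lambda>p. Always (Imp (St p) (Fut (Unbounded False 0) Bd))) [0..<B]),
     Conjs (map (\<lambda>p. Always (Imp (Conj (St p) (Fut (Unbounded False 1) Bd)) (Up (St p)))) [0..<B]),
     Conjs (map (\<lambda>p. Always (Imp (Conj (St p) High) (Down (St p)))) [0..<B]),
     Always (Imp (St 0) (Neg (Fut (Bounded False 0 1 False) (St 0)))),
     Conjs (map (\<lambda>k. Always (Imp (Rg k) (Fut (Unbounded False 0) Bd))) [0..<B]),
     Conjs (map (\<lambda>p. Conjs (map (\<lambda>k. Always (Imp (Conj (St p) (Rg k)) (Action B k (P ! p)))) [0..<B]))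
       [0..<length P]),
     Always (Imp (St (Suc (length P))) (Neg (Imp TT TT))),
     Neg (St 0),
     Fut (Bounded False 0 1 False)
       (Conj (St 0) (Conjs (map Rg (filter (\<lambda>k. k \<noteq> 1 \<and> k \<noteq> 2) [0..<B]))))]"

text \<open>The shape is the same for every \<open>l\<close>; only the endpoints vary, which makes
  the code computable from \<open>l\<close>.\<close>

definition Input :: "nat \<Rightarrow> nat \<Rightarrow> 'p mtl" where
  "Input k l = Fut (Bounded False l (Suc l) True) (Conj (St 0) (Rg k))"

text \<open>The program is a conjunct \<open>a\<close> independent of the inputs, so its code can be
  inserted unchanged.\<close>

definition Instance :: "nat \<Rightarrow> nat \<Rightarrow> 'p mtl \<Rightarrow> 'p mtl" where
  "Instance m n a = Conj (Conj (Input 1 m) (Input 2 n)) a"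

lemma vars_Conjs [simp]: "mtl_vars (Conjs as) = (\<Union>a \<in> set as. mtl_vars a)"
  by (induction as) (auto simp: Conjs_def Imp_def)

lemma vars_derived [simp]:
  "mtl_vars (Imp a c) = mtl_vars a \<union> mtl_vars c"
  "mtl_vars (Fut I a) = mtl_vars a"
  "mtl_vars (Past I a) = mtl_vars a"
  "mtl_vars (Always a) = mtl_vars a"
  "mtl_vars (Up a) = insert 0 (mtl_vars a)"
  "mtl_vars (Down a) = insert 0 (mtl_vars a)"
  "mtl_vars High = {state_var 0}"
  "mtl_vars (Grid B) = state_var ` {..<B}"
  "mtl_vars (Next B a) = insert (state_var 0) (state_var ` {..<B} \<union> mtl_vars a)"
  by (auto simp: Imp_def Fut_def Past_def Always_def Up_def Down_def High_def Grid_def Next_def)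

lemma over_Conjs [simp]: "mtl_over AP (Conjs as) \<longleftrightarrow> (\<forall>a \<in> set as. mtl_over AP a)"
  by (induction as) (auto simp: Conjs_def Imp_def)

lemma over_derived [simp]:
  "mtl_over AP (Imp a c) \<longleftrightarrow> mtl_over AP a \<and> mtl_over AP c"
  "mtl_over AP (Fut I a) \<longleftrightarrow> nonsingular I \<and> mtl_over AP a"
  "mtl_over AP (Past I a) \<longleftrightarrow> nonsingular I \<and> mtl_over AP a"
  "mtl_over AP (Always a) \<longleftrightarrow> mtl_over AP a"
  "mtl_over AP (Up a) \<longleftrightarrow> mtl_over AP a"
  "mtl_over AP (Down a) \<longleftrightarrow> mtl_over AP a"
  "mtl_over AP High"
  "mtl_over AP (Grid B)"
  "mtl_over AP (Next B a) \<longleftrightarrow> mtl_over AP a"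
  by (auto simp: Imp_def Fut_def Past_def Always_def Up_def Down_def High_def Grid_def Next_def)

lemma over_Action [simp]: "mtl_over AP (Action B k i)"
  by (cases i) auto

lemma over_Instance: "mtl_over AP (Instance m n (Program P B))"
  by (auto simp: Instance_def Input_def Program_def)

lemma vars_Action:
  assumes "k < B" "targets i \<subseteq> {..<B}"
  shows "mtl_vars (Action B k i) \<subseteq> {..2 * B + 1}"
  using assms by (cases i) (auto simp: state_var_def reg_var_def)

lemma vars_Instance:
  assumes "bounded_by B P"
  shows "mtl_vars (Instance m n (Program P B)) \<subseteq> {..2 * B + 1}"
proof -
  have "targets (P ! p) \<subseteq> {..<B}" if "p < length P" for p
  proof -
    have "targets (P ! p) \<subseteq> {1..<B}" using assms nth_mem[OF that] unfolding bounded_by_def by blast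
    then show ?thesis by auto
  qed
  then have "mtl_vars (Action B k (P ! p)) \<subseteq> {..2 * B + 1}" if "k < B" "p < length P" for k p
    using that by (intro vars_Action)
  then have A: "x \<le> Suc (2 * B)" if "x \<in> mtl_vars (Action B k (P ! p))" "k < B" "p < length P" for x k p
    using that by fastforce
  show ?thesis
    using assms by (auto simp: Instance_def Input_def Program_def bounded_by_def state_var_def reg_var_def dest!: A)
qed

lemma ssat_Conjs [simp]: "ssat E U t (Conjs as) \<longleftrightarrow> (\<forall>a \<in> set as. ssat E U t a)"
  by (induction as) (auto simp: Conjs_def Imp_def)

lemma ssat_derived [simp]:
  "ssat E U t (Imp a c) \<longleftrightarrow> (ssat E U t a \<longrightarrow> ssat E U t c)"
  "ssat E U t (Fut I a) \<longleftrightarrow> (\<exists>t'>t. t' - t \<in> ivl_set I \<and> t' \<in> U \<and> ssat E U t' a)"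
  "ssat E U t (Past I a) \<longleftrightarrow> (\<exists>t'\<ge>0. t' < t \<and> t - t' \<in> ivl_set I \<and> t' \<in> U \<and> ssat E U t' a)"
  by (auto simp: Imp_def Fut_def Past_def)

lemma ssat_Always: "ssat E U 0 (Always a) \<longleftrightarrow> (\<forall>t>0. t \<in> U \<longrightarrow> ssat E U t a)"
  by (auto simp: Always_def)

section \<open>Meaning of the formulas in terms of event sets\<close>

locale event_sets =
  fixes E :: "nat \<Rightarrow> real set" and U :: "real set" and B :: nat
  assumes events: "x \<le> 2 * B + 1 \<Longrightarrow> E x \<subseteq> U"
    and nonneg: "E 0 \<subseteq> {0..}" and B_pos: "0 < B"
begin

abbreviation "SE p \<equiv> E (state_var p)"
abbreviation "RE k \<equiv> E (reg_var k)"

lemma in_U: "t \<in> E 0 \<Longrightarrow> t \<in> U" "t \<in> E (Suc 0) \<Longrightarrow> t \<in> U" "p < B \<Longrightarrow> t \<in> SE p \<Longrightarrow> t \<in> U"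
  "k < B \<Longrightarrow> t \<in> RE k \<Longrightarrow> t \<in> U"
  using events[of 0] events[of "Suc 0"] events[of "state_var p"] events[of "reg_var k"]
  by (auto simp: state_var_def reg_var_def)

text \<open>The formula sees only events after \<open>t\<close>, but earlier ones lie below
  \<open>t + 1\<close> anyway; so its premise speaks about all of \<open>E 0\<close>.\<close>

lemma ssat_Up: "ssat E U t (Up a) \<longleftrightarrow> (t + 1 \<in> E 0 \<and> (\<forall>y \<in> E 0. y \<le> t + 1) \<longrightarrow> ssat E U (t + 1) a)"
proof
  assume L: "ssat E U t (Up a)"
  show "t + 1 \<in> E 0 \<and> (\<forall>y \<in> E 0. y \<le> t + 1) \<longrightarrow> ssat E U (t + 1) a"
  proof
    assume Y: "t + 1 \<in> E 0 \<and> (\<forall>y \<in> E 0. y \<le> t + 1)"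
    have "\<exists>t'>t. t' - t \<in> ivl_set (Unbounded True 1) \<and> t' \<in> U \<and> t' \<in> E 0"
      using Y in_U(1) by (intro exI[of _ "t + 1"]) auto
    moreover have "\<not> (\<exists>t'>t. t' - t \<in> ivl_set (Unbounded False 1) \<and> t' \<in> U \<and> t' \<in> E 0)"
      using Y by force
    ultimately obtain u where "u - t \<in> ivl_set (Unbounded True 1)" "u \<in> E 0" "ssat E U u a"
      using L unfolding Up_def ssat_derived ssat.simps by blast
    moreover from this have "u = t + 1" using Y by force
    ultimately show "ssat E U (t + 1) a" by simp
  qed
next
  assume R: "t + 1 \<in> E 0 \<and> (\<forall>y \<in> E 0. y \<le> t + 1) \<longrightarrow> ssat E U (t + 1) a"
  show "ssat E U t (Up a)"
    unfolding Up_def ssat_derived ssat.simps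
  proof (intro impI, elim conjE exE)
    fix u
    assume n: "\<not> (\<exists>t'>t. t' - t \<in> ivl_set (Unbounded False 1) \<and> t' \<in> U \<and> t' \<in> E 0)"
      and u: "t < u" "u - t \<in> ivl_set (Unbounded True 1)" "u \<in> U" "u \<in> E 0"
    have le: "y \<le> t + 1" if "y \<in> E 0" for y
    proof (rule ccontr)
      assume "\<not> y \<le> t + 1"
      then have "t < y \<and> y - t \<in> ivl_set (Unbounded False 1) \<and> y \<in> U \<and> y \<in> E 0"
        using that in_U(1) by auto
      then show False using n by blast
    qed
    with u have "u = t + 1" by fastforce
    then show "\<exists>t'>t. t' - t \<in> ivl_set (Unbounded True 1) \<and> t' \<in> U \<and> t' \<in> E 0 \<and> ssat E U t' a"
      using R le u by (intro exI[of _ u]) auto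
  qed
qed

text \<open>The mirror image of \<open>ssat_Up\<close>, except that past operators look only at
  nonnegative times; \<open>nonneg\<close> ensures that no event of \<open>E 0\<close> is
  missed.\<close>

lemma ssat_Down: "ssat E U t (Down a) \<longleftrightarrow> (t - 1 \<in> E 0 \<and> (\<forall>y \<in> E 0. t - 1 \<le> y) \<longrightarrow> ssat E U (t - 1) a)"
proof
  assume L: "ssat E U t (Down a)"
  show "t - 1 \<in> E 0 \<and> (\<forall>y \<in> E 0. t - 1 \<le> y) \<longrightarrow> ssat E U (t - 1) a"
  proof
    assume Y: "t - 1 \<in> E 0 \<and> (\<forall>y \<in> E 0. t - 1 \<le> y)"
    have "\<exists>t'\<ge>0. t' < t \<and> t - t' \<in> ivl_set (Unbounded True 1) \<and> t' \<in> U \<and> t' \<in> E 0"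
      using Y in_U(1) nonneg by (intro exI[of _ "t - 1"]) auto
    moreover have "\<not> (\<exists>t'\<ge>0. t' < t \<and> t - t' \<in> ivl_set (Unbounded False 1) \<and> t' \<in> U \<and> t' \<in> E 0)"
      using Y by force
    ultimately obtain u where "t - u \<in> ivl_set (Unbounded True 1)" "u \<in> E 0" "ssat E U u a"
      using L unfolding Down_def ssat_derived ssat.simps by blast
    moreover from this have "u = t - 1" using Y by force
    ultimately show "ssat E U (t - 1) a" by simp
  qed
next
  assume R: "t - 1 \<in> E 0 \<and> (\<forall>y \<in> E 0. t - 1 \<le> y) \<longrightarrow> ssat E U (t - 1) a"
  show "ssat E U t (Down a)"
    unfolding Down_def ssat_derived ssat.simps
  proof (intro impI, elim conjE exE)
    fix u
    assume n: "\<not> (\<exists>t'\<ge>0. t' < t \<and> t - t' \<in> ivl_set (Unbounded False 1) \<and> t' \<in> U \<and> t' \<in> E 0)"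
      and u: "0 \<le> u" "u < t" "t - u \<in> ivl_set (Unbounded True 1)" "u \<in> U" "u \<in> E 0"
    have le: "t - 1 \<le> y" if "y \<in> E 0" for y
    proof (rule ccontr)
      assume "\<not> t - 1 \<le> y"
      then have "0 \<le> y \<and> y < t \<and> t - y \<in> ivl_set (Unbounded False 1) \<and> y \<in> U \<and> y \<in> E 0"
        using that in_U(1) nonneg by auto
      then show False using n by blast
    qed
    with u have "u = t - 1" by fastforce
    then show "\<exists>t'\<ge>0. t' < t \<and> t - t' \<in> ivl_set (Unbounded True 1) \<and> t' \<in> U \<and> t' \<in> E 0 \<and> ssat E U t' a"
      using R le u by (intro exI[of _ u]) auto
  qed
qed

lemma ssat_High: "ssat E U t High \<longleftrightarrow> high SE t"
proof
  assume "ssat E U t High"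
  then show "high SE t" by (force simp: High_def high_def)
next
  assume "high SE t"
  then obtain z where z: "z \<in> SE 0" "0 \<le> z" "z + 1 \<le> t" by (auto simp: high_def)
  then show "ssat E U t High"
    using in_U(3)[OF B_pos] by (auto simp: High_def intro!: exI[of _ z])
qed

lemma ssat_Grid: "ssat E U t (Grid B) \<longleftrightarrow> t \<in> (\<Union>p<B. SE p)"
  by (auto simp: Grid_def)

text \<open>\<open>Until\<close> ranges over all event times, including those of the universal
  trace, but only grid points falsify its left argument, and all of them are event times.\<close>

lemma ssat_Next: "ssat E U t (Next B a) \<longleftrightarrow> (\<exists>t'. next_point B SE t t' \<and> ssat E U t' a)"
proof -
  define G where "G = (\<Union>p<B. SE p)"
  have G_U: "t' \<in> U" if "t' \<in> G" for t'
    using that in_U(3) by (auto simp: G_def)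
  have "t' - t \<in> ivl_set (Unbounded False 0) \<longleftrightarrow> t < t'" for t'
    by simp
  then show ?thesis
    unfolding Next_def next_point_def ssat.simps ssat_Grid G_def[symmetric] greaterThanLessThan_iff Ball_def
    using G_U by blast
qed

lemma ssat_Action:
  assumes "k < B"
  shows "ssat E U t (Action B k i) \<longleftrightarrow> action B SE RE (E 0) k i t"
  by (cases i) (auto simp: ssat_Next ssat_Up ssat_Down ssat_High up_def down_def simp del: One_nat_def)

lemma ssat_Always_Imp:
  assumes "\<And>t. ssat E U t a \<Longrightarrow> t \<in> U"
  shows "ssat E U 0 (Always (Imp a c)) \<longleftrightarrow> (\<forall>t>0. ssat E U t a \<longrightarrow> ssat E U t c)"
  using assms by (auto simp: ssat_Always)

lemma ssat_Fut_Ev: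
  assumes "E x \<subseteq> U"
  shows "ssat E U t (Fut (Unbounded False l) (Ev x)) \<longleftrightarrow> (\<exists>z \<in> E x. t + real l < z)"
proof
  assume "\<exists>z \<in> E x. t + real l < z"
  then obtain z where "z \<in> E x" "t + real l < z" by blast
  then show "ssat E U t (Fut (Unbounded False l) (Ev x))"
    using assms by (auto intro!: exI[of _ z])
qed (force simp: algebra_simps)

lemma ssat_Fut_Bounded:
  assumes "\<And>t. ssat E U t a \<Longrightarrow> t \<in> SE 0"
  shows "ssat E U t (Fut (Bounded False l u c) a) \<longleftrightarrow>
    (\<exists>z \<in> SE 0. t + real l < z \<and> (if c then z \<le> t + real u else z < t + real u) \<and> ssat E U z a)"
proof
  assume "\<exists>z \<in> SE 0. t + real l < z \<and> (if c then z \<le> t + real u else z < t + real u) \<and> ssat E U z a"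
  then obtain z where "z \<in> SE 0" "t + real l < z" "if c then z \<le> t + real u else z < t + real u" "ssat E U z a"
    by blast
  then show "ssat E U t (Fut (Bounded False l u c) a)"
    using in_U(3)[OF B_pos] by (auto intro!: exI[of _ z] split: if_splits)
next
  assume "ssat E U t (Fut (Bounded False l u c) a)"
  then obtain z where "t < z" "z - t \<in> ivl_set (Bounded False l u c)" "ssat E U z a" by auto
  then show "\<exists>z \<in> SE 0. t + real l < z \<and> (if c then z \<le> t + real u else z < t + real u) \<and> ssat E U z a"
    using assms by (intro bexI[of _ z]) (auto split: if_splits)
qed

text \<open>Each \<open>Always\<close> is guarded by a literal and each remaining operator looks for
  one; as their events lie in \<open>U\<close>, the restriction to event times disappears clause by
  clause.\<close>

lemma ssat_Instance:
  assumes "bounded_by B P"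
  shows "ssat E U 0 (Instance m n (Program P B)) \<longleftrightarrow> encodes P B m n SE RE (E 1) (E 0)"
proof -
  have len: "p < length P \<Longrightarrow> p < B" "Suc (length P) < B" for p
    using assms by (auto simp: bounded_by_def)
  have E1: "E 1 \<subseteq> U" using in_U(2) by auto
  have fut: "ssat E U t (Fut (Unbounded False 0) Bd) \<longleftrightarrow> (\<exists>z \<in> E 1. t < z)"
    "ssat E U t (Fut (Unbounded False (Suc 0)) Bd) \<longleftrightarrow> (\<exists>z \<in> E 1. t + 1 < z)" for t
    using ssat_Fut_Ev[OF E1, of t 0] ssat_Fut_Ev[OF E1, of t "Suc 0"] by (simp_all del: ssat_derived(2))
  note [simp] = fut ssat_Up ssat_Down ssat_High up_def down_def and [simp del] = ssat_derived(2)
  have c1: "ssat E U 0 (Always (Imp (St p) (Fut (Unbounded False 0) Bd))) \<longleftrightarrow>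
      (\<forall>t>0. t \<in> SE p \<longrightarrow> (\<exists>z \<in> E 1. t < z))" if "p < B" for p
    by (subst ssat_Always_Imp) (use in_U(3)[OF that] in auto)
  have c2: "ssat E U 0 (Always (Imp (Conj (St p) (Fut (Unbounded False 1) Bd)) (Up (St p)))) \<longleftrightarrow>
      (\<forall>t>0. t \<in> SE p \<and> (\<exists>z \<in> E 1. t + 1 < z) \<longrightarrow> up (E 0) (SE p) t)" if "p < B" for p
    by (subst ssat_Always_Imp) (use in_U(3)[OF that] in auto)
  have c3: "ssat E U 0 (Always (Imp (Conj (St p) High) (Down (St p)))) \<longleftrightarrow>
      (\<forall>t>0. t \<in> SE p \<and> high SE t \<longrightarrow> down (E 0) (SE p) t)" if "p < B" for p
    by (subst ssat_Always_Imp) (use in_U(3)[OF that] in auto)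
  have c4: "ssat E U 0 (Always (Imp (St 0) (Neg (Fut (Bounded False 0 1 False) (St 0))))) \<longleftrightarrow>
      (\<forall>t>0. t \<in> SE 0 \<longrightarrow> \<not> (\<exists>z \<in> SE 0. t < z \<and> z < t + 1))"
  proof -
    have "ssat E U t (Fut (Bounded False 0 (Suc 0) False) (St 0)) \<longleftrightarrow>
        (\<exists>z \<in> SE 0. t < z \<and> z < t + 1)" for t
      by (subst ssat_Fut_Bounded) auto
    then show ?thesis
      by (subst ssat_Always_Imp) (use in_U(3)[OF B_pos] in auto)
  qed
  have c5: "ssat E U 0 (Always (Imp (Rg k) (Fut (Unbounded False 0) Bd))) \<longleftrightarrow>
      (\<forall>t>0. t \<in> RE k \<longrightarrow> (\<exists>z \<in> E 1. t < z))" if "k < B" for k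
    by (subst ssat_Always_Imp) (use in_U(4)[OF that] in auto)
  have c6: "ssat E U 0 (Always (Imp (Conj (St p) (Rg k)) (Action B k (P ! p)))) \<longleftrightarrow>
      (\<forall>t>0. t \<in> SE p \<and> t \<in> RE k \<longrightarrow> action B SE RE (E 0) k (P ! p) t)" if "p < length P" "k < B" for p k
    by (subst ssat_Always_Imp) (use in_U(4)[OF that(2)] in \<open>auto simp: ssat_Action[OF that(2)]\<close>)
  have c7: "ssat E U 0 (Always (Imp (St (Suc (length P))) (Neg (Imp TT TT)))) \<longleftrightarrow>
      (\<forall>t>0. t \<notin> SE (Suc (length P)))"
    by (subst ssat_Always_Imp) (use in_U(3)[OF len(2)] in auto)
  have c8: "ssat E U 0 (Fut (Bounded False 0 1 False)
        (Conj (St 0) (Conjs (map Rg (filter (\<lambda>k. k \<noteq> 1 \<and> k \<noteq> 2) [0..<B]))))) \<longleftrightarrow>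
      (\<exists>t \<in> SE 0. 0 < t \<and> t < 1 \<and> (\<forall>k<B. k \<noteq> 1 \<and> k \<noteq> 2 \<longrightarrow> t \<in> RE k))"
    by (subst ssat_Fut_Bounded) auto
  have c9: "ssat E U 0 (Input k l) \<longleftrightarrow>
      (\<exists>t \<in> SE 0. real l < t \<and> t \<le> real l + 1 \<and> t \<in> RE k)" for k l
    unfolding Input_def by (subst ssat_Fut_Bounded) (auto simp: add.commute)
  have all: "(\<forall>x \<in> {0..<b}. Q x) \<longleftrightarrow> (\<forall>x<b. Q x)" for b :: nat and Q by auto
  show ?thesis
    unfolding Instance_def Program_def encodes_def
    by (simp add: c1 c2 c3 c4 c5 c6 c7 c8 c9 all del: ssat_derived up_def down_def One_nat_def)
      (intro iffI conjI; elim conjE; assumption)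
qed

end

lemma event_sets_of:
  assumes "Y \<in> time_sets" "0 < B"
  shows "event_sets (E(0 := Y)) (Y \<union> (\<Union>x\<in>{1..2 * B + 1}. E x)) B"
proof
  fix x
  assume "x \<le> 2 * B + 1"
  then have "x = 0 \<or> x \<in> {1..2 * B + 1}" by auto
  then show "(E(0 := Y)) x \<subseteq> Y \<union> (\<Union>x\<in>{1..2 * B + 1}. E x)" by auto
qed (use assms in \<open>auto simp: time_sets_def\<close>)

lemma ssat_Instance_iff:
  assumes "bounded_by B P" "Y \<in> time_sets"
  shows "ssat (E(0 := Y)) (Y \<union> (\<Union>x\<in>{1..2 * B + 1}. E x)) 0 (Instance m n (Program P B)) \<longleftrightarrow>
    encodes P B m n (\<lambda>p. E (state_var p)) (\<lambda>k. E (reg_var k)) (E 1) Y"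
proof -
  have "0 < B" using assms(1) by (simp add: bounded_by_def)
  from event_sets.ssat_Instance[OF event_sets_of[OF assms(2) this] assms(1)]
  show ?thesis by (simp add: state_var_def reg_var_def)
qed

lemma set_truth_not_rejecting:
  assumes "bounded_by B P" "set_truth (2 * B + 1) (Instance m n (Program P B :: 'p mtl))"
  shows "fst ((step P ^^ i) (0, input m n)) \<noteq> Suc (length P)"
proof -
  obtain E where E: "\<forall>Y \<in> time_sets.
      ssat (E(0 := Y)) (Y \<union> (\<Union>x\<in>{1..2 * B + 1}. E x)) 0 (Instance m n (Program P B :: 'p mtl))"
    using assms(2) unfolding set_truth_def by blast
  have "encoded_machine P B m n (\<lambda>p. E (state_var p)) (\<lambda>k. E (reg_var k)) (E 1)"
  proof
    show "encodes P B m n (\<lambda>p. E (state_var p)) (\<lambda>k. E (reg_var k)) (E 1) Y" if "Y \<in> time_sets" for Y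
      using bspec[OF E that] unfolding ssat_Instance_iff[OF assms(1) that] .
  qed (rule assms(1))
  then show ?thesis by (rule encoded_machine.not_rejecting)
qed

lemma set_truth_accepting:
  assumes "accepting_run P B m n H"
  shows "set_truth (2 * B + 1) (Instance m n (Program P B))"
proof -
  interpret accepting_run P B m n H by fact
  \<comment> \<open>This inverts the numbering of the variables; the value at \<open>0\<close> is
    immediately overwritten by \<open>Y\<close>.\<close>
  define E where "E x = (if x = 1 then {\<tau> (W * N)} else if even x then SS ((x - 2) div 2) else RR ((x - 3) div 2))"
    for x :: nat
  have E: "(\<lambda>p. E (state_var p)) = SS" "(\<lambda>k. E (reg_var k)) = RR" "E 1 = {\<tau> (W * N)}"
    by (auto simp: E_def state_var_def reg_var_def fun_eq_iff)
  have "E x \<in> time_sets" for x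
    using time_sets_run by (simp add: E_def)
  moreover have "ssat (E(0 := Y)) (Y \<union> (\<Union>x\<in>{1..2 * B + 1}. E x)) 0 (Instance m n (Program P B))"
    if "Y \<in> time_sets" for Y
    unfolding ssat_Instance_iff[OF bounded that] E by (rule encodes_run)
  ultimately show ?thesis unfolding set_truth_def by (intro exI[of _ E] conjI ballI) auto
qed

lemma bounded_by_exists:
  assumes "\<forall>i \<in> set P. 0 \<notin> targets i"
  shows "\<exists>B. bounded_by B P"
proof -
  have fin: "finite (regs i)" "finite (targets i)" for i
    by (cases i; simp)+
  have "finite ({2, Suc (length P)} \<union> (\<Union>i \<in> set P. regs i \<union> targets i))"
    by (simp add: fin)
  then obtain B where B: "\<forall>x \<in> {2, Suc (length P)} \<union> (\<Union>i \<in> set P. regs i \<union> targets i). x < B"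
    unfolding finite_nat_set_iff_bounded by blast
  have "regs i \<subseteq> {..<B} \<and> targets i \<subseteq> {1..<B}" if "i \<in> set P" for i
  proof -
    have "0 < x" if "x \<in> targets i" for x using that assms \<open>i \<in> set P\<close> by (cases x) auto
    then show ?thesis using B \<open>i \<in> set P\<close> by fastforce
  qed
  then show ?thesis using B unfolding bounded_by_def by (intro exI[of _ B]) simp
qed

text \<open>Take the first halting time. Halted configurations are fixed by \<open>step\<close>, so
  the address reached then is the one seen at time \<open>i\<close>.\<close>

lemma accepting_run_exists:
  assumes "bounded_by B P" "P \<noteq> []" "fst ((step P ^^ i) (0, input m n)) = length P"
  shows "\<exists>H. accepting_run P B m n H"
proof -
  let ?c = "\<lambda>i. (step P ^^ i) (0, input m n)"
  define H where "H = (LEAST i. \<not> fst (?c i) < length P)"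
  have H: "\<not> fst (?c H) < length P"
    unfolding H_def by (rule LeastI[of _ i]) (use assms(3) in simp)
  have run: "fst (?c j) < length P" if "j < H" for j
    using not_less_Least[of j "\<lambda>i. \<not> fst (?c i) < length P"] that unfolding H_def by blast
  have "H \<le> i" unfolding H_def by (rule Least_le) (use assms(3) in simp)
  have "?c (H + d) = ?c H" for d
  proof (induction d)
    case (Suc d)
    obtain p v where pv: "?c H = (p, v)" by fastforce
    have "?c (H + Suc d) = step P (p, v)" using Suc by (simp add: pv del: step.simps)
    then show ?case using H by (simp add: pv)
  qed simp
  from this[of "i - H"] have "fst (?c H) = length P" using \<open>H \<le> i\<close> assms(3) by simp
  then have "accepting_run P B m n H" using assms(1,2) run by unfold_locales auto
  then show ?thesis by blast
qed

section \<open>Diagonalisation\<close>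

text \<open>The instance is given the code \<open>n\<close> of its own machine as input, so that no universal machine
  is needed for the diagonal argument.\<close>

lemma diagonal_instance:
  "\<exists>m n (\<psi> :: nat mtl). encode_mtl \<psi> = n \<and> mtl_vars (Instance m n \<psi>) \<subseteq> {..m} \<and>
    (\<forall>AP. mtl_over AP (Instance m n \<psi>)) \<and>
    (\<forall>y. computes g [m, n] y \<longrightarrow> (set_truth m (Instance m n \<psi>) \<longleftrightarrow> y = 0))"
proof -
  obtain P where P: "P \<noteq> []" "\<forall>i \<in> set P. 0 \<notin> targets i"
    "\<And>m n y. computes g [m, n] y \<Longrightarrow> \<exists>i. fst ((step P ^^ i) (0, input m n)) =
      (if y = 0 then length P else Suc (length P))"
    using machine_for_recf[of g] by blast
  obtain B where B: "bounded_by B P" using bounded_by_exists[OF P(2)] by blast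
  define \<psi> :: "nat mtl" where "\<psi> = Program P B"
  \<comment> \<open>The number of existential traces: the bound, \<open>B\<close> states and
    \<open>B\<close> registers. It depends on the machine, which therefore receives it as an
    input.\<close>
  define m where "m = 2 * B + 1"
  have "set_truth m (Instance m (encode_mtl \<psi>) \<psi>) \<longleftrightarrow> y = 0" if y: "computes g [m, encode_mtl \<psi>] y" for y
  proof -
    obtain i where i: "fst ((step P ^^ i) (0, input m (encode_mtl \<psi>))) =
        (if y = 0 then length P else Suc (length P))"
      using P(3)[OF y] by blast
    show ?thesis
    proof (cases "y = 0")
      case True
      then have "\<exists>H. accepting_run P B m (encode_mtl \<psi>) H"
        using accepting_run_exists[OF B P(1)] i by auto
      then show ?thesis
        using True set_truth_accepting unfolding m_def \<psi>_def by blast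
    next
      case False
      then show ?thesis
        using set_truth_not_rejecting[OF B, of m "encode_mtl \<psi>" i] i unfolding m_def \<psi>_def by auto
    qed
  qed
  then show ?thesis
    using vars_Instance[OF B] over_Instance by (intro exI[of _ m] exI[of _ "encode_mtl \<psi>"] exI[of _ \<psi>])
      (auto simp: m_def \<psi>_def)
qed

text \<open>The block binds \<open>m\<close> down to \<open>1\<close>, so its code is a primitive
  recursion on \<open>m\<close>; the tag selects the quantifier.\<close>

definition prefix_code :: "nat \<Rightarrow> nat \<Rightarrow> nat \<Rightarrow> nat" where
  "prefix_code tag m c = rec_nat c (\<lambda>k y. list_encode [tag, Suc k, y]) m"

lemma encode_prefix:
  "encode_hyper (exists_upto m \<phi>) = prefix_code 0 m (encode_hyper \<phi>)"
  "encode_hyper (forall_upto m \<phi>) = prefix_code 1 m (encode_hyper \<phi>)"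
  unfolding prefix_code_def by (induction m) simp_all

lemma computable_list_encode:
  "computable n (\<lambda>xs. list_encode [])"
  "computable n F \<Longrightarrow> computable n (\<lambda>xs. list_encode (G xs)) \<Longrightarrow> computable n (\<lambda>xs. list_encode (F xs # G xs))"
  by (simp_all add: computable_const computable_Suc computable_prod_encode)

lemma computable_prefix_code:
  assumes "computable n F" "computable n G"
  shows "computable n (\<lambda>xs. prefix_code tag (F xs) (G xs))"
  unfolding prefix_code_def
  by (intro computable_rec_nat assms computable_list_encode computable_const computable_Suc computable_nth) simp_all

lemma computable_Input:
  "computable n F \<Longrightarrow> computable n (\<lambda>xs. encode_mtl (Input k (F xs)))"
  unfolding Input_def Fut_def encode_mtl.simps encode_ivl.simps
  by (intro computable_list_encode computable_const computable_Suc)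

text \<open>The numerals are the constructor tags of the formula encoding. Both arguments occur in
  two roles: \<open>xs ! 0\<close> as prefix length and first input, \<open>xs ! 1\<close> as second
  input and, verbatim, as the code of the program conjunct.\<close>

lemma computable_instance_code:
  "computable 2 (\<lambda>xs. list_encode [a, prefix_code tag (xs ! 0) (list_encode [tag', 0, list_encode [2,
    list_encode [3, list_encode [3, encode_mtl (Input 1 (xs ! 0)), encode_mtl (Input 2 (xs ! 1))], xs ! 1]]])])"
  "computable 2 (\<lambda>xs. list_encode [a, prefix_code tag (xs ! 0) (list_encode [tag', 0, list_encode [2,
    list_encode [4, list_encode [3, list_encode [3, encode_mtl (Input 1 (xs ! 0)), encode_mtl (Input 2 (xs ! 1))],
      xs ! 1]]]])])"
  by (intro computable_list_encode computable_prefix_code computable_Input computable_const computable_nth; simp)+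

theorem theorem3:
  fixes AP :: "nat set"
  assumes "finite AP"
  shows "\<not> mc_decidable AP exists_forall \<and> \<not> mc_decidable AP forall_exists"
proof
  let ?A = "universal_ta AP"
  have A: "timed_automaton ?A" "alphabet ?A = Pow AP"
    using universal_ta[OF assms] by (auto simp: universal_ta_def)
  show "\<not> mc_decidable AP exists_forall"
  proof
    assume "mc_decidable AP exists_forall"
    then obtain f where f: "\<And>x. x \<in> mc_instances AP exists_forall \<Longrightarrow>
        computes f [encode_instance x] (if (\<lambda>(A, \<phi>). models (language A) \<phi>) x then 1 else 0)"
      unfolding mc_decidable_def decidable_on_def by blast
    obtain h where h: "\<And>xs. length xs = 2 \<Longrightarrow> computes h xs (list_encode [encode_ta ?A,
        prefix_code 0 (xs ! 0) (list_encode [1, 0, list_encode [2, list_encode [3, list_encode [3,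
          encode_mtl (Input 1 (xs ! 0)), encode_mtl (Input 2 (xs ! 1))], xs ! 1]]])])"
      using computable_instance_code(1)[of "encode_ta ?A" 0 1] unfolding computable_def by blast
    obtain m n and \<psi> :: "nat mtl" where \<psi>: "encode_mtl \<psi> = n" "mtl_vars (Instance m n \<psi>) \<subseteq> {..m}"
      "\<And>AP. mtl_over AP (Instance m n \<psi>)"
      "\<And>y. computes (Comp f [h]) [m, n] y \<Longrightarrow> set_truth m (Instance m n \<psi>) \<longleftrightarrow> y = 0"
      using diagonal_instance[of "Comp f [h]"] by blast
    let ?\<phi> = "exists_upto m (Forall 0 (Body (Instance m n \<psi>)))"
    have "(?A, ?\<phi>) \<in> mc_instances AP exists_forall"
      using A \<psi> by (simp add: mc_instances_def closed_prefix exists_forall_prefix)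
    from f[OF this] have "computes f [encode_instance (?A, ?\<phi>)] (if set_truth m (Instance m n \<psi>) then 1 else 0)"
      using models_iff_set_truth(1)[OF \<psi>(3,2)] by (simp add: language_universal_ta)
    moreover have "computes h [m, n] (encode_instance (?A, ?\<phi>))"
      using h[of "[m, n]"] \<psi>(1) by (simp add: encode_instance_def encode_prefix Instance_def del: list_encode.simps)
    ultimately have "computes (Comp f [h]) [m, n] (if set_truth m (Instance m n \<psi>) then 1 else 0)"
      by (intro computes.comp[where ys = "[encode_instance (?A, ?\<phi>)]"]) simp_all
    \<comment> \<open>The machine outputs \<open>1\<close> if the instance is true, while the
      instance is true exactly if the output is \<open>0\<close>.\<close>
    from \<psi>(4)[OF this] show False by (simp split: if_splits)
  qed
  show "\<not> mc_decidable AP forall_exists"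
  proof
    assume "mc_decidable AP forall_exists"
    then obtain f where f: "\<And>x. x \<in> mc_instances AP forall_exists \<Longrightarrow>
        computes f [encode_instance x] (if (\<lambda>(A, \<phi>). models (language A) \<phi>) x then 1 else 0)"
      unfolding mc_decidable_def decidable_on_def by blast
    obtain h where h: "\<And>xs. length xs = 2 \<Longrightarrow> computes h xs (list_encode [encode_ta ?A,
        prefix_code 1 (xs ! 0) (list_encode [0, 0, list_encode [2, list_encode [4, list_encode [3, list_encode [3,
          encode_mtl (Input 1 (xs ! 0)), encode_mtl (Input 2 (xs ! 1))], xs ! 1]]]])])"
      using computable_instance_code(2)[of "encode_ta ?A" 1 0] unfolding computable_def by blast
    \<comment> \<open>The dual formula holds exactly if \<open>set_truth\<close> fails, so the
      decider's answer is flipped; unflipped, it would agree with the diagonal instance.\<close>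
    have "computable 1 (\<lambda>xs. rec_nat 1 (\<lambda>_ _. 0) (xs ! 0))"
      by (intro computable_rec_nat computable_const computable_nth) simp
    then obtain neg where neg: "\<And>y. computes neg [y] (rec_nat 1 (\<lambda>_ _. 0) y)"
      unfolding computable_def by (metis One_nat_def length_Cons list.size(3) nth_Cons_0)
    obtain m n and \<psi> :: "nat mtl" where \<psi>: "encode_mtl \<psi> = n" "mtl_vars (Instance m n \<psi>) \<subseteq> {..m}"
      "\<And>AP. mtl_over AP (Instance m n \<psi>)"
      "\<And>y. computes (Comp neg [Comp f [h]]) [m, n] y \<Longrightarrow> set_truth m (Instance m n \<psi>) \<longleftrightarrow> y = 0"
      using diagonal_instance[of "Comp neg [Comp f [h]]"] by blast
    let ?\<phi> = "forall_upto m (Exists 0 (Body (Neg (Instance m n \<psi>))))"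
    let ?y = "if set_truth m (Instance m n \<psi>) then 0 else 1 :: nat"
    have "(?A, ?\<phi>) \<in> mc_instances AP forall_exists"
      using A \<psi> by (simp add: mc_instances_def closed_prefix forall_exists_prefix)
    from f[OF this] have "computes f [encode_instance (?A, ?\<phi>)] ?y"
      using models_iff_set_truth(2)[OF \<psi>(3,2)]
      by (cases "set_truth m (Instance m n \<psi>)") (simp_all add: language_universal_ta)
    moreover have "computes h [m, n] (encode_instance (?A, ?\<phi>))"
      using h[of "[m, n]"] \<psi>(1) by (simp add: encode_instance_def encode_prefix Instance_def del: list_encode.simps)
    ultimately have "computes (Comp f [h]) [m, n] ?y"
      by (intro computes.comp[where ys = "[encode_instance (?A, ?\<phi>)]"]) simp_all
    then have "computes (Comp neg [Comp f [h]]) [m, n] (rec_nat 1 (\<lambda>_ _. 0) ?y)"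
      using neg by (intro computes.comp[where ys = "[?y]"]) simp_all
    from \<psi>(4)[OF this] show False by (simp split: if_splits)
  qed
qed

end
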